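(* Let $\pi = 1 \oplus \rho$, where $\rho$ starts with a descent (i.e. $\rho(1)>\rho(2)$) and $\rho$ has no decreasing bond, and suppose $\pi$ satisfies condition $(\ddagger)$: there is at least one entry of $\pi$ lying to the right of the entry of value $2$ whose value is less than the value of the leftmost entry of $\rho$ (i.e. less than $\pi(2)$). Then the class $\operatorname{Av}(\pi)$ is not deflatable.
   Context: A permutation $\alpha$ is contained in $\beta$ if $\beta$ has a subsequence in the same relative order as $\alpha$; a class is a set of permutations closed under taking contained permutations; $\operatorname{Av}(\pi)$ is the class of permutations not containing $\pi$. $1\oplus\rho$ denotes a new minimum entry placed before a copy of $\rho$. A bond of a permutation is a pair of entries in adjacent positions whose values differ by $1$; it is decreasing if they form the pattern $21$. An interval of a permutation is a set of entries whose positions and values each form a set of consecutive integers, the whole permutation not counting as an interval; a permutation is simple if all its intervals are single entries (so $1$, $12$, $21$ are simple). A class $\mathcal{C}$ is deflatable if there is a proper subclass $\mathcal{D}\subsetneq\mathcal{C}$ with $\mathcal{C}\subseteq\langle\mathcal{D}\rangle$, where the substitution closure $\langle\mathcal{D}\rangle$ is the largest class whose simple permutations are exactly those of $\mathcal{D}$; equivalently, $\mathcal{C}$ is not deflatable if and only if every permutation in $\mathcal{C}$ is contained in some simple permutation belonging to $\mathcal{C}$. *)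

theory Defs
  imports "HOL-Combinatorics.Multiset_Permutations" "HOL-Library.Sublist"
begin

text \<open>Permutations are written in one-line notation, as lists of the values \<open>1, \<dots>, n\<close>. List positions
  count from 0, so the entry \<open>p(i)\<close> of the mathematical notation is \<open>p ! (i - 1)\<close>. The empty
  permutation is admitted; it belongs to every nonempty class.\<close>

definition is_perm :: "nat list \<Rightarrow> bool" where
  "is_perm p \<longleftrightarrow> p \<in> permutations_of_set {1..length p}"

definition order_isomorphic :: "nat list \<Rightarrow> nat list \<Rightarrow> bool" where
  "order_isomorphic xs ys \<longleftrightarrow> length xs = length ys \<and>
     (\<forall>i < length xs. \<forall>j < length xs. xs ! i < xs ! j \<longleftrightarrow> ys ! i < ys ! j)"

definition contained_in :: "nat list \<Rightarrow> nat list \<Rightarrow> bool" where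
  "contained_in \<alpha> \<beta> \<longleftrightarrow> (\<exists>s. subseq s \<beta> \<and> order_isomorphic \<alpha> s)"

definition perm_class :: "nat list set \<Rightarrow> bool" where
  "perm_class C \<longleftrightarrow> (\<forall>p \<in> C. is_perm p) \<and>
     (\<forall>\<beta> \<in> C. \<forall>\<alpha>. is_perm \<alpha> \<and> contained_in \<alpha> \<beta> \<longrightarrow> \<alpha> \<in> C)"

definition Av :: "nat list \<Rightarrow> nat list set" where
  "Av \<pi> = {p. is_perm p \<and> \<not> contained_in \<pi> p}"

definition one_oplus :: "nat list \<Rightarrow> nat list" where
  "one_oplus \<rho> = 1 # map Suc \<rho>"

text \<open>A bond is named by the position \<open>i\<close> of its left entry.\<close>

definition bond :: "nat list \<Rightarrow> nat \<Rightarrow> bool" where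
  "bond p i \<longleftrightarrow> Suc i < length p \<and> (p ! Suc i = Suc (p ! i) \<or> p ! i = Suc (p ! Suc i))"

definition decreasing_bond :: "nat list \<Rightarrow> nat \<Rightarrow> bool" where
  "decreasing_bond p i \<longleftrightarrow> bond p i \<and> p ! i > p ! Suc i"

text \<open>A set of entries is represented by its set \<open>I\<close> of positions. Strictness of the inclusion
  excludes the whole permutation.\<close>

definition is_interval :: "nat list \<Rightarrow> nat set \<Rightarrow> bool" where
  "is_interval p I \<longleftrightarrow> I \<noteq> {} \<and> I \<subset> {..<length p} \<and>
     (\<exists>a b. I = {a..b}) \<and> (\<exists>c d. (\<lambda>i. p ! i) ` I = {c..d})"

definition simple_perm :: "nat list \<Rightarrow> bool" where
  "simple_perm p \<longleftrightarrow> is_perm p \<and> (\<forall>I. is_interval p I \<longrightarrow> card I = 1)"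

definition simples :: "nat list set \<Rightarrow> nat list set" where
  "simples C = {p \<in> C. simple_perm p}"

text \<open>The largest class with the same simple permutations as \<open>D\<close>, obtained as the union of all such
  classes; \<open>substitution_closure_greatest\<close> shows that it is itself such a class.\<close>

definition substitution_closure :: "nat list set \<Rightarrow> nat list set" where
  "substitution_closure D = \<Union> {E. perm_class E \<and> simples E = simples D}"

lemma substitution_closure_greatest:
  assumes "perm_class D"
  shows "perm_class (substitution_closure D)"
    and "simples (substitution_closure D) = simples D"
    and "\<And>E. perm_class E \<Longrightarrow> simples E = simples D \<Longrightarrow> E \<subseteq> substitution_closure D"
proof -
  show "perm_class (substitution_closure D)"
    unfolding substitution_closure_def perm_class_def by blast
  have "simples (substitution_closure D) = \<Union> {simples E | E. perm_class E \<and> simples E = simples D}"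
    unfolding substitution_closure_def simples_def by blast
  also have "\<dots> = simples D"
    using assms by blast
  finally show "simples (substitution_closure D) = simples D" .
  show "\<And>E. perm_class E \<Longrightarrow> simples E = simples D \<Longrightarrow> E \<subseteq> substitution_closure D"
    unfolding substitution_closure_def by blast
qed

definition deflatable :: "nat list set \<Rightarrow> bool" where
  "deflatable C \<longleftrightarrow> (\<exists>D. perm_class D \<and> D \<subset> C \<and> C \<subseteq> substitution_closure D)"

definition starts_with_descent :: "nat list \<Rightarrow> bool" where
  "starts_with_descent p \<longleftrightarrow> 2 \<le> length p \<and> p ! 0 > p ! 1"

text \<open>Condition \<open>(\<ddagger>)\<close>: \<open>i\<close> is the position of the value 2, and \<open>p ! 1\<close> is the second entry.\<close>

definition ddagger :: "nat list \<Rightarrow> bool" where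
  "ddagger p \<longleftrightarrow> (\<exists>i j. i < j \<and> j < length p \<and> p ! i = 2 \<and> p ! j < p ! 1)"

end

theory Submission
  imports Defs Complex_Main
begin

text \<open>A permutation avoiding \<open>\<pi>\<close> is drawn as a finite planar point set in general position, and points are
  added to it, keeping \<open>\<pi>\<close> avoided, until every proper interval has been cut.

  Two preliminary steps make the set skew-indecomposable and, by adding new left-to-right minima, ensure
  that every proper interval contains a left-to-right minimum. Then no point lies to the left of and below
  a proper interval \<open>I\<close>, and skew-indecomposability provides points to the right of and above it. Let \<open>f\<close>
  be the lowest of these and \<open>w\<close> the lowest point of \<open>I\<close>. The new point \<open>z\<close> is put immediately to the right
  of \<open>f\<close> and immediately above \<open>w\<close>. In a copy of \<open>\<pi>\<close> using \<open>z\<close>, no entry lies vertically between \<open>z\<close> and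
  \<open>f\<close>: such an entry would force \<open>w\<close> to play 1 and \<open>z\<close> to play 2, and the entry provided by \<open>(\<ddagger>)\<close> would lie in
  \<open>I\<close> by its value but not by its position. So \<open>z\<close> and \<open>f\<close> play a decreasing bond, or \<open>f\<close> can replace \<open>z\<close>.
  The point \<open>z\<close> cuts \<open>I\<close> and creates no new intervals, so the process terminates.\<close>

subsection \<open>Point sets, copies and intervals\<close>

type_synonym point = "real \<times> real"

definition general_position :: "point set \<Rightarrow> bool" where
  "general_position S \<longleftrightarrow> finite S \<and> inj_on fst S \<and> inj_on snd S"

text \<open>One implication between the values suffices, since copies are only taken of lists without repetitions.\<close>

definition copy_of :: "nat list \<Rightarrow> point set \<Rightarrow> (nat \<Rightarrow> point) \<Rightarrow> bool" where
  "copy_of \<alpha> S f \<longleftrightarrow> (\<forall>i < length \<alpha>. f i \<in> S) \<and>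
     (\<forall>i j. i < j \<and> j < length \<alpha> \<longrightarrow> fst (f i) < fst (f j)) \<and>
     (\<forall>i < length \<alpha>. \<forall>j < length \<alpha>. \<alpha> ! i < \<alpha> ! j \<longrightarrow> snd (f i) < snd (f j))"

definition avoids :: "nat list \<Rightarrow> point set \<Rightarrow> bool" where
  "avoids \<alpha> S \<longleftrightarrow> (\<nexists>f. copy_of \<alpha> S f)"

text \<open>Coordinates are arbitrary reals, so "consecutive" becomes the absence of an outside
  point separating two members horizontally or vertically. The empty set and singletons qualify
  here; \<open>proper_intervals\<close> discards them.\<close>

definition interval_of :: "point set \<Rightarrow> point set \<Rightarrow> bool" where
  "interval_of S K \<longleftrightarrow> K \<subseteq> S \<and> (\<forall>c \<in> S - K. \<forall>a \<in> K. \<forall>b \<in> K.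
     \<not> (fst a < fst c \<and> fst c < fst b) \<and> \<not> (snd a < snd c \<and> snd c < snd b))"

definition proper_intervals :: "point set \<Rightarrow> point set set" where
  "proper_intervals S = {K. interval_of S K \<and> 2 \<le> card K \<and> K \<noteq> S}"

definition lr_min :: "point set \<Rightarrow> point \<Rightarrow> bool" where
  "lr_min S m \<longleftrightarrow> m \<in> S \<and> (\<forall>p \<in> S. \<not> (fst p < fst m \<and> snd p < snd m))"

text \<open>A member is the upper left summand of a decomposition of \<open>S\<close> as a skew sum,
  so \<open>skew_cuts S = {}\<close> expresses skew-indecomposability.\<close>

definition skew_cuts :: "point set \<Rightarrow> point set set" where
  "skew_cuts S = {A. A \<noteq> {} \<and> A \<subset> S \<and> (\<forall>a \<in> A. \<forall>b \<in> S - A. fst a < fst b \<and> snd b < snd a)}"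

text \<open>Supplies the coordinates of new points: putting a point "immediately above" or
  "immediately to the right of" another means choosing such an \<open>x\<close>.\<close>

lemma gap_above:
  fixes a :: real
  assumes "finite A"
  obtains x where "a < x" "\<And>b. b \<in> A \<Longrightarrow> a < b \<Longrightarrow> x < b"
proof -
  \<comment> \<open>The extra element \<open>a + 1\<close> keeps \<open>B\<close> nonempty, so that
    \<open>Min B\<close> makes sense even if nothing in \<open>A\<close> exceeds
    \<open>a\<close>.\<close>
  define B where "B = insert (a + 1) {b \<in> A. a < b}"
  have B: "finite B" "B \<noteq> {}" "\<forall>b \<in> B. a < b" using assms by (auto simp: B_def)
  have "a < Min B" using B Min_in by blast
  then obtain x where x: "a < x" "x < Min B" using dense[of a "Min B"] by blast
  have "x < b" if "b \<in> A" "a < b" for b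
    using x Min_le[of B b] B(1) that by (simp add: B_def)
  then show ?thesis using that[of x] x(1) by simp
qed

lemma gap_below:
  fixes a :: real
  assumes "finite A"
  obtains x where "x < a" "\<And>b. b \<in> A \<Longrightarrow> b < a \<Longrightarrow> b < x"
proof -
  obtain x where x: "- a < x" and above: "\<And>b. b \<in> uminus ` A \<Longrightarrow> - a < b \<Longrightarrow> x < b"
    using gap_above[of "uminus ` A" "- a"] assms by auto
  have "b < - x" if "b \<in> A" "b < a" for b
    using above[of "- b"] that by simp
  then show ?thesis using that[of "- x"] x by simp
qed

section \<open>Enlarging a point set by one point\<close>

lemma general_position_insert:
  assumes "general_position S" "fst z \<notin> fst ` S" "snd z \<notin> snd ` S"
  shows "general_position (insert z S)"
  using assms unfolding general_position_def by auto

lemma general_position_eqI: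
  assumes "general_position S" "p \<in> S" "q \<in> S" "fst p = fst q \<or> snd p = snd q"
  shows "p = q"
  using assms unfolding general_position_def inj_on_def by metis

lemma avoids_insert:
  assumes "avoids \<alpha> S"
    and "\<And>f k. copy_of \<alpha> (insert z S) f \<Longrightarrow> k < length \<alpha> \<Longrightarrow> f k = z \<Longrightarrow> False"
  shows "avoids \<alpha> (insert z S)"
  unfolding avoids_def
proof
  assume "\<exists>f. copy_of \<alpha> (insert z S) f"
  then obtain f where f: "copy_of \<alpha> (insert z S) f" by blast
  then have "f k \<noteq> z" if "k < length \<alpha>" for k using assms(2) that by blast
  then have "copy_of \<alpha> S f" using f unfolding copy_of_def by blast
  then show False using assms(1) unfolding avoids_def by blast
qed

text \<open>If no point of the copy separates \<open>z\<close> from \<open>p\<close> in either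
  coordinate, then \<open>p\<close> can take over the role of \<open>z\<close>. As \<open>p\<close>
  is an old point, this turns a new copy into an old one, which contradicts avoidance.\<close>

lemma copy_replace:
  assumes f: "copy_of \<alpha> (insert z S) f" and k: "k < length \<alpha>" "f k = z" and p: "p \<in> S"
    and x: "\<And>i. i < length \<alpha> \<Longrightarrow> fst (f i) < fst z \<Longrightarrow> fst (f i) < fst p"
      "\<And>i. i < length \<alpha> \<Longrightarrow> fst z < fst (f i) \<Longrightarrow> fst p < fst (f i)"
    and y: "\<And>i. i < length \<alpha> \<Longrightarrow> snd (f i) < snd z \<Longrightarrow> snd (f i) < snd p"
      "\<And>i. i < length \<alpha> \<Longrightarrow> snd z < snd (f i) \<Longrightarrow> snd p < snd (f i)"
  shows "copy_of \<alpha> S (f(k := p))"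
proof -
  have "f i \<in> S" if "i < length \<alpha>" "i \<noteq> k" for i
  proof -
    have "fst (f i) \<noteq> fst (f k)"
      using f k that unfolding copy_of_def by (metis less_irrefl linorder_neqE_nat)
    then show ?thesis using f k that unfolding copy_of_def by auto
  qed
  then show ?thesis
    unfolding copy_of_def
  proof (intro conjI allI impI)
    fix i j assume "i < j \<and> j < length \<alpha>"
    then have ij: "i < j" "i < length \<alpha>" "j < length \<alpha>" by auto
    then have "fst (f i) < fst (f j)" using f unfolding copy_of_def by blast
    then show "fst ((f(k := p)) i) < fst ((f(k := p)) j)"
      using ij x[of i] x[of j] k(2) by auto
  next
    fix i j assume ij: "i < length \<alpha>" "j < length \<alpha>" "\<alpha> ! i < \<alpha> ! j"
    then have "snd (f i) < snd (f j)" using f unfolding copy_of_def by blast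
    then show "snd ((f(k := p)) i) < snd ((f(k := p)) j)"
      using ij y[of i] y[of j] k(2) by auto
  qed (use p in auto)
qed

section \<open>Intervals, extreme points and skew cuts\<close>

lemma interval_fst:
  assumes "general_position S" "interval_of S K" "c \<in> S" "c \<notin> K"
  shows "(\<forall>a \<in> K. fst c < fst a) \<or> (\<forall>a \<in> K. fst a < fst c)"
proof (rule ccontr)
  assume "\<not> ?thesis"
  then obtain a b where ab: "a \<in> K" "b \<in> K" "\<not> fst c < fst a" "\<not> fst b < fst c" by blast
  moreover have "fst a \<noteq> fst c" "fst b \<noteq> fst c"
    using ab assms general_position_eqI[OF assms(1)] unfolding interval_of_def by blast+
  ultimately have "fst a < fst c" "fst c < fst b" by auto
  then show False using assms ab unfolding interval_of_def by blast
qed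

lemma interval_snd:
  assumes "general_position S" "interval_of S K" "c \<in> S" "c \<notin> K"
  shows "(\<forall>a \<in> K. snd c < snd a) \<or> (\<forall>a \<in> K. snd a < snd c)"
proof (rule ccontr)
  assume "\<not> ?thesis"
  then obtain a b where ab: "a \<in> K" "b \<in> K" "\<not> snd c < snd a" "\<not> snd b < snd c" by blast
  moreover have "snd a \<noteq> snd c" "snd b \<noteq> snd c"
    using ab assms general_position_eqI[OF assms(1)] unfolding interval_of_def by blast+
  ultimately have "snd a < snd c" "snd c < snd b" by auto
  then show False using assms ab unfolding interval_of_def by blast
qed

text \<open>Makes \<open>J \<mapsto> J - {z}\<close> a map from the intervals of the enlarged set to
  those of \<open>S\<close>; \<open>destroy_interval\<close> counts intervals with it.\<close>

lemma interval_of_Diff: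
  assumes "interval_of (insert z S) J" "z \<notin> S"
  shows "interval_of S (J - {z})"
  using assms unfolding interval_of_def by blast

lemma finite_proper_intervals: "finite S \<Longrightarrow> finite (proper_intervals S)"
  unfolding proper_intervals_def interval_of_def
  by (rule finite_subset[of _ "Pow S"]) auto

lemma finite_skew_cuts: "finite S \<Longrightarrow> finite (skew_cuts S)"
  unfolding skew_cuts_def by (rule finite_subset[of _ "Pow S"]) auto

lemma ex_lowest:
  fixes S :: "point set"
  assumes "finite S" "S \<noteq> {}"
  obtains w where "w \<in> S" "\<And>p. p \<in> S \<Longrightarrow> snd w \<le> snd p"
  using that[of "arg_min_on snd S"] arg_min_if_finite(1)[OF assms] arg_min_least[OF assms] by blast

lemma ex_leftmost:
  fixes S :: "point set"
  assumes "finite S" "S \<noteq> {}"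
  obtains w where "w \<in> S" "\<And>p. p \<in> S \<Longrightarrow> fst w \<le> fst p"
  using that[of "arg_min_on fst S"] arg_min_if_finite(1)[OF assms] arg_min_least[OF assms] by blast

lemma skew_cut_sameside:
  assumes "A \<in> skew_cuts S" "p \<in> S" "q \<in> S" "fst p < fst q" "snd p < snd q"
  shows "p \<in> A \<longleftrightarrow> q \<in> A"
proof -
  have *: "fst a < fst b" "snd b < snd a" if "a \<in> A" "b \<in> S" "b \<notin> A" for a b
    using assms(1) that unfolding skew_cuts_def by blast+
  show ?thesis using *[of p q] *[of q p] assms by auto
qed

text \<open>Deleting \<open>z\<close> from a cut of the enlarged set would leave a cut of
  \<open>S\<close>, unless one side of the cut is \<open>z\<close> alone. The point \<open>u\<close>
  prevents \<open>z\<close> from being the whole upper left side, and \<open>v\<close> from being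
  the whole lower right side.\<close>

lemma skew_cuts_insert_empty:
  assumes "skew_cuts S = {}" "z \<notin> S" "u \<in> S" "v \<in> S"
    and u: "fst u < fst z \<or> snd z < snd u" and v: "fst z < fst v \<or> snd v < snd z"
  shows "skew_cuts (insert z S) = {}"
proof (rule ccontr)
  assume "skew_cuts (insert z S) \<noteq> {}"
  then obtain A where A: "A \<noteq> {}" "A \<subset> insert z S"
    and cut: "\<And>a b. a \<in> A \<Longrightarrow> b \<in> insert z S - A \<Longrightarrow> fst a < fst b \<and> snd b < snd a"
    unfolding skew_cuts_def by blast
  have "A - {z} \<in> skew_cuts S" if "A - {z} \<noteq> {}" "\<not> S \<subseteq> A"
    unfolding skew_cuts_def
  proof (intro CollectI conjI ballI)
    show "A - {z} \<noteq> {}" by (fact that(1))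
    show "A - {z} \<subset> S" using A(2) that(2) by blast
    fix a b assume "a \<in> A - {z}" "b \<in> S - (A - {z})"
    then show "fst a < fst b" "snd b < snd a" using cut[of a b] assms(2) by auto
  qed
  then have "A - {z} = {} \<or> S \<subseteq> A" using assms(1) by blast
  then have "A = {z} \<or> S \<subseteq> A" using A(1) by blast
  then show False
  proof
    assume "A = {z}"
    then show False using cut[of z u] u assms(2,3) by auto
  next
    assume "S \<subseteq> A"
    then have "z \<notin> A" using A by blast
    then show False using cut[of v z] v assms(4) \<open>S \<subseteq> A\<close> by auto
  qed
qed

lemma copy_other:
  assumes f: "copy_of \<alpha> (insert z S) f" and k: "k < length \<alpha>" "f k = z" and i: "i < length \<alpha>" "i \<noteq> k"
  shows "f i \<in> S"
proof -
  have "fst (f i) \<noteq> fst (f k)"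
    using f k i unfolding copy_of_def by (metis less_irrefl linorder_neqE_nat)
  then show ?thesis using f k i unfolding copy_of_def by auto
qed

lemma copy_fst_less:
  assumes "copy_of \<alpha> S f" "i < length \<alpha>" "j < length \<alpha>"
  shows "fst (f i) < fst (f j) \<longleftrightarrow> i < j"
  using assms unfolding copy_of_def by (metis less_asym linorder_neqE_nat less_irrefl)

lemma copy_snd_less:
  assumes "copy_of \<alpha> S f" "distinct \<alpha>" "i < length \<alpha>" "j < length \<alpha>"
  shows "snd (f i) < snd (f j) \<longleftrightarrow> \<alpha> ! i < \<alpha> ! j"
  using assms unfolding copy_of_def by (metis less_asym linorder_neqE_nat less_irrefl nth_eq_iff_index_eq)

subsection \<open>Inserting a point below and to the right of another\<close>

text \<open>The hypotheses are put in terms of relative order, the only thing a copy sees: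
  \<open>t\<close> is the index of the entry 2, characterised as the least entry after the first,
  and the absence of a decreasing bond becomes the presence of an entry of intermediate
  value.\<close>

locale ddagger_pattern =
  fixes \<pi> :: "nat list"
  assumes distinct: "distinct \<pi>"
    and min_first: "\<And>i. 0 < i \<Longrightarrow> i < length \<pi> \<Longrightarrow> \<pi> ! 0 < \<pi> ! i"
    and ddagger: "\<exists>t j. 0 < t \<and> t < j \<and> j < length \<pi> \<and> \<pi> ! j < \<pi> ! 1 \<and>
      (\<forall>i. 0 < i \<and> i < length \<pi> \<longrightarrow> \<pi> ! t \<le> \<pi> ! i)"
    and no_decreasing_bond: "\<And>i. 0 < i \<Longrightarrow> Suc i < length \<pi> \<Longrightarrow> \<pi> ! Suc i < \<pi> ! i \<Longrightarrow>
      \<exists>l < length \<pi>. \<pi> ! Suc i < \<pi> ! l \<and> \<pi> ! l < \<pi> ! i"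
begin

text \<open>By distinctness the entry at \<open>j\<close> strictly exceeds the one at
  \<open>t\<close>; the entry at 1 is larger still, so \<open>t\<close> cannot be 1.\<close>

lemma ddagger_indices:
  obtains t j where "1 < t" "t < j" "j < length \<pi>" "\<pi> ! t < \<pi> ! j" "\<pi> ! j < \<pi> ! 1"
    "\<And>i. 0 < i \<Longrightarrow> i < length \<pi> \<Longrightarrow> \<pi> ! t \<le> \<pi> ! i"
proof -
  obtain t j where tj: "0 < t" "t < j" "j < length \<pi>" "\<pi> ! j < \<pi> ! 1"
    "\<And>i. 0 < i \<Longrightarrow> i < length \<pi> \<Longrightarrow> \<pi> ! t \<le> \<pi> ! i"
    using ddagger by blast
  have "\<pi> ! t \<noteq> \<pi> ! j" using tj distinct by (simp add: nth_eq_iff_index_eq)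
  then have "\<pi> ! t < \<pi> ! j" using tj(5)[of j] tj(1-3) by linarith
  moreover have "1 < t" using tj \<open>\<pi> ! t < \<pi> ! j\<close> by (cases "t = 1") auto
  ultimately show ?thesis using that tj by blast
qed

lemma length_gt_2: "2 < length \<pi>"
proof -
  obtain t j where "1 < t" "t < j" "j < length \<pi>" using ddagger_indices .
  then show ?thesis by simp
qed

lemma copy_first:
  assumes "copy_of \<pi> S g" "0 < i" "i < length \<pi>"
  shows "fst (g 0) < fst (g i)" "snd (g 0) < snd (g i)"
proof -
  have "0 < length \<pi>" using assms by linarith
  then show "fst (g 0) < fst (g i)" "snd (g 0) < snd (g i)"
    using assms min_first[of i] copy_fst_less[of \<pi> S g 0 i] copy_snd_less[of \<pi> S g 0 i] distinct
    by auto
qed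

text \<open>Nothing of \<open>S\<close> lies horizontally between \<open>f\<close> and
  \<open>z\<close>, or vertically between \<open>w\<close> and \<open>z\<close>. Hence
  \<open>z\<close> can be exchanged for \<open>w\<close> if it plays 1, and for \<open>f\<close> if
  the copy misses \<open>f\<close> and has no entry vertically between the two.\<close>

lemma avoids_insert_decreasing:
  assumes gp: "general_position S" and av: "avoids \<pi> S" and int: "interval_of S I"
    and w: "w \<in> I" "\<And>p. p \<in> I \<Longrightarrow> snd w \<le> snd p"
    and left: "\<And>p. p \<in> S \<Longrightarrow> p \<notin> I \<Longrightarrow> fst p < fst w \<Longrightarrow> snd w < snd p"
    and f: "f \<in> S" "\<And>p. p \<in> I \<Longrightarrow> fst p < fst f \<and> snd p < snd f"
    and f_min: "\<And>p. p \<in> S \<Longrightarrow> \<forall>q \<in> I. fst q < fst p \<and> snd q < snd p \<Longrightarrow> snd f \<le> snd p"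
    and zx: "fst f < fst z" "\<And>p. p \<in> S \<Longrightarrow> fst f < fst p \<Longrightarrow> fst z < fst p"
    and zy: "snd w < snd z" "\<And>p. p \<in> S \<Longrightarrow> snd w < snd p \<Longrightarrow> snd z < snd p"
  shows "avoids \<pi> (insert z S)"
proof (rule avoids_insert[OF av])
  fix g k assume g: "copy_of \<pi> (insert z S) g" and k: "k < length \<pi>" "g k = z"
  have IS: "I \<subseteq> S" using int unfolding interval_of_def by blast
  have inS: "g i \<in> S" if "i < length \<pi>" "i \<noteq> k" for i using copy_other[OF g k that] .
  have avS: "\<not> copy_of \<pi> S h" for h using av unfolding avoids_def by blast
  have len: "0 < length \<pi>" using k by linarith
  have wz: "fst w < fst z" using f(2)[OF w(1)] zx(1) by simp
  have zf: "snd z < snd f" using zy(2)[OF f(1)] f(2)[OF w(1)] by simp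
  \<comment> \<open>If \<open>z\<close> played the minimum, all other points of the copy would lie
    above it and to its right, and \<open>w\<close>, which lies below \<open>z\<close> and to its
    left, could replace it.\<close>
  have k0: "0 < k"
  proof (rule ccontr)
    assume "\<not> 0 < k"
    then have k': "k = 0" by simp
    have "copy_of \<pi> S (g(k := w))"
    proof (rule copy_replace[OF g k])
      show "w \<in> S" using w IS by blast
      fix i assume i: "i < length \<pi>"
      have ge: "fst z \<le> fst (g i)" "snd z \<le> snd (g i)"
        using copy_first[OF g, of i] k' k(2) i by (cases "i = 0"; simp)+
      show "fst (g i) < fst w" if "fst (g i) < fst z" using ge that by simp
      show "snd (g i) < snd w" if "snd (g i) < snd z" using ge that by simp
      show "fst w < fst (g i)" if "fst z < fst (g i)" using wz that by simp
      show "snd w < snd (g i)" if "snd z < snd (g i)" using zy(1) that by simp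
    qed
    then show False using avS by blast
  qed
  define x where "x = g 0"
  have x: "x \<in> S" "fst x < fst z" "snd x < snd z"
    using inS[of 0] len k0 copy_first[OF g k0 k(1)] k(2) by (auto simp: x_def)
  then have xw: "snd x \<le> snd w" using zy(2)[of x] by fastforce
  \<comment> \<open>A copy point \<open>p\<close> at such a height would lie in \<open>I\<close>
    together with \<open>x\<close>. Then \<open>x = w\<close> plays 1 and \<open>z\<close> plays 2.
    The entry \<open>j\<close> from \<open>ddagger_indices\<close> comes after \<open>z\<close>,
    hence lies to the right of \<open>I\<close>, although its height is between those of
    \<open>w\<close> and \<open>g 1\<close>, two points of \<open>I\<close>.\<close>
  have outside: "\<not> (snd z < snd (g i) \<and> snd (g i) < snd f)" if i: "i < length \<pi>" "i \<noteq> k" for i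
  proof
    assume *: "snd z < snd (g i) \<and> snd (g i) < snd f"
    define p where "p = g i"
    have pS: "p \<in> S" using inS i by (simp add: p_def)
    have p: "snd w < snd p" "snd p < snd f" using * zy(1) by (auto simp: p_def)
    have "i \<noteq> 0"
    proof
      assume "i = 0"
      then show False using * x(3) by (simp add: x_def)
    qed
    then have xp: "fst x < fst p" using copy_first(1)[OF g] i by (simp add: x_def p_def)
    \<comment> \<open>Outside \<open>I\<close>, the point \<open>p\<close> would be above
      \<open>I\<close>. It is not also to the right, since \<open>f\<close> is the lowest such
      point. On the left, it would force \<open>x\<close> to lie to the left of \<open>I\<close> and
      no higher than \<open>w\<close>, against \<open>left\<close>.\<close>
    have pI: "p \<in> I"
    proof (rule ccontr)
      assume pI: "p \<notin> I"
      then have "\<forall>q \<in> I. snd q < snd p"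
        using interval_snd[OF gp int pS] w(1) p(1) by fastforce
      then have "\<not> (\<forall>q \<in> I. fst q < fst p)" using f_min[OF pS] p(2) by fastforce
      then have pl: "\<forall>q \<in> I. fst p < fst q" using interval_fst[OF gp int pS pI] by blast
      then have "x \<notin> I" using xp by fastforce
      moreover have "fst x < fst w" using pl w(1) xp by fastforce
      ultimately show False using left[OF x(1)] xw by simp
    qed
    have xI: "x \<in> I"
    proof (rule ccontr)
      assume xI: "x \<notin> I"
      then have "\<forall>q \<in> I. fst x < fst q" using interval_fst[OF gp int x(1)] pI xp by fastforce
      then show False using left[OF x(1) xI] w(1) xw by fastforce
    qed
    then have "snd x = snd w" using w(2) xw by fastforce
    then have xw: "x = w" using general_position_eqI[OF gp x(1), of w] w(1) IS by blast
    obtain t j where tj: "1 < t" "t < j" "j < length \<pi>" "\<pi> ! t < \<pi> ! j" "\<pi> ! j < \<pi> ! 1"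
      "\<And>i. 0 < i \<Longrightarrow> i < length \<pi> \<Longrightarrow> \<pi> ! t \<le> \<pi> ! i"
      by (rule ddagger_indices) blast
    \<comment> \<open>The point \<open>g t\<close> is the lowest of the copy after \<open>x\<close>.
      If it were not \<open>z\<close>, its height would fall into the empty gap between
      \<open>w\<close> and \<open>z\<close>.\<close>
    have kt: "k = t"
    proof (rule ccontr)
      assume kt: "k \<noteq> t"
      have t: "t < length \<pi>" "0 < t" using tj by auto
      have "\<pi> ! t \<noteq> \<pi> ! k" using kt t k distinct by (simp add: nth_eq_iff_index_eq)
      then have "\<pi> ! t < \<pi> ! k" using tj(6)[OF k0 k(1)] by simp
      then have "snd (g t) < snd z" using copy_snd_less[OF g distinct t(1) k(1)] k(2) by simp
      moreover have "snd w < snd (g t)" using copy_first(2)[OF g t(2) t(1)] xw by (simp add: x_def)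
      ultimately show False using zy(2)[of "g t"] inS[of t] t kt by fastforce
    qed
    have l1: "1 < length \<pi>" "1 \<noteq> k" using tj kt by auto
    \<comment> \<open>Horizontally \<open>g 1\<close> is between \<open>x\<close> and
      \<open>p\<close>, or equal to \<open>p\<close>, and both of these lie in
      \<open>I\<close>.\<close>
    have g1: "g 1 \<in> I"
    proof (rule ccontr)
      assume "g 1 \<notin> I"
      moreover have "fst x < fst (g 1)" using copy_first(1)[OF g _ l1(1)] by (simp add: x_def)
      moreover have "fst (g 1) \<le> fst p"
        using copy_fst_less[OF g l1(1) i(1)] \<open>i \<noteq> 0\<close> by (cases "i = 1") (auto simp: p_def)
      moreover have "g 1 \<noteq> p" using pI \<open>g 1 \<notin> I\<close> by blast
      then have "fst (g 1) \<noteq> fst p" using general_position_eqI[OF gp inS[OF l1] pS] by blast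
      ultimately show False using interval_fst[OF gp int inS[OF l1]] xI pI by fastforce
    qed
    have j: "j < length \<pi>" "j \<noteq> k" using tj kt by auto
    have "fst z < fst (g j)" using copy_fst_less[OF g k(1) j(1)] k(2) kt tj(2) by simp
    then have "g j \<notin> I" using f(2) zx(1) by fastforce
    moreover have "snd w < snd (g j)" using copy_first(2)[OF g _ j(1)] tj xw by (simp add: x_def)
    moreover have "snd (g j) < snd (g 1)" using copy_snd_less[OF g distinct j(1) l1(1)] tj by simp
    ultimately show False using interval_snd[OF gp int inS[OF j]] w(1) g1 by fastforce
  qed
  \<comment> \<open>If the copy uses \<open>f\<close>, then \<open>f\<close> and \<open>z\<close>
    are consecutive in it and form a descent, so the entry from \<open>no_decreasing_bond\<close>
    has a height ruled out by \<open>outside\<close>. If it does not, \<open>f\<close> replaces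
    \<open>z\<close>.\<close>
  show False
  proof (cases "\<exists>i < length \<pi>. g i = f")
    case True
    then obtain i where i: "i < length \<pi>" "g i = f" by blast
    have ik: "i < k" using copy_fst_less[OF g i(1) k(1)] i k zx(1) by simp
    have "\<not> Suc i < k"
    proof
      assume s: "Suc i < k"
      then have l: "Suc i < length \<pi>" "Suc i \<noteq> k" using k by auto
      then have "fst f < fst (g (Suc i))" "fst (g (Suc i)) < fst z"
        using copy_fst_less[OF g i(1) l(1)] copy_fst_less[OF g l(1) k(1)] i(2) k(2) s by auto
      then show False using zx(2)[OF inS[OF l]] by simp
    qed
    then have ks: "k = Suc i" using ik by simp
    have "i \<noteq> 0"
    proof
      assume "i = 0"
      then show False using i(2) x(3) zf by (simp add: x_def)
    qed
    then have "0 < i" by simp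
    moreover have "\<pi> ! Suc i < \<pi> ! i"
      using copy_snd_less[OF g distinct k(1) i(1)] k(2) i(2) zf ks by simp
    ultimately obtain l where l: "l < length \<pi>" "\<pi> ! Suc i < \<pi> ! l" "\<pi> ! l < \<pi> ! i"
      using no_decreasing_bond k(1) ks by blast
    then have "snd z < snd (g l)" "snd (g l) < snd f"
      using copy_snd_less[OF g distinct k(1) l(1)] copy_snd_less[OF g distinct l(1) i(1)] k(2) i(2) ks
      by auto
    then show False using outside[OF l(1)] l(2) ks by auto
  next
    case False
    have "copy_of \<pi> S (g(k := f))"
    proof (rule copy_replace[OF g k f(1)])
      fix i assume i: "i < length \<pi>"
      have neq: "fst (g i) \<noteq> fst f" "snd (g i) \<noteq> snd f" if "i \<noteq> k"
        using general_position_eqI[OF gp inS[OF i that] f(1)] False i by blast+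
      show "fst (g i) < fst f" if "fst (g i) < fst z"
      proof -
        have "i \<noteq> k" using that k(2) by auto
        then show ?thesis using neq zx(2)[OF inS[OF i]] that by fastforce
      qed
      show "fst f < fst (g i)" if "fst z < fst (g i)" using that zx(1) by simp
      show "snd (g i) < snd f" if "snd (g i) < snd z" using that zf by simp
      show "snd f < snd (g i)" if "snd z < snd (g i)"
      proof -
        have "i \<noteq> k" using that k(2) by auto
        then show ?thesis using neq outside[OF i] that by fastforce
      qed
    qed
    then show False using avS by blast
  qed
qed

end

subsection \<open>Cutting intervals\<close>

definition meets_lr_min :: "point set \<Rightarrow> bool" where
  "meets_lr_min S \<longleftrightarrow> (\<forall>K \<in> proper_intervals S. \<exists>m \<in> K. lr_min S m)"

lemma lr_min_insert:
  assumes "lr_min S m" "\<not> (fst z < fst m \<and> snd z < snd m)"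
  shows "lr_min (insert z S) m"
  using assms unfolding lr_min_def by blast

text \<open>A point to the left of \<open>I\<close> is either above or below all of it, and below
  would contradict that \<open>m\<close> is a left-to-right minimum.\<close>

lemma interval_left_above:
  assumes gp: "general_position S" and int: "interval_of S I" and m: "m \<in> I" "lr_min S m"
    and p: "p \<in> S" "p \<notin> I" "q \<in> I" "fst p < fst q"
  shows "\<forall>r \<in> I. fst p < fst r \<and> snd r < snd p"
proof -
  have left: "\<forall>r \<in> I. fst p < fst r" using interval_fst[OF gp int p(1,2)] p(3,4) by fastforce
  then have "\<not> snd p < snd m" using m p(1) unfolding lr_min_def by blast
  then have "\<forall>r \<in> I. snd r < snd p" using interval_snd[OF gp int p(1,2)] m(1) by blast
  then show ?thesis using left by blast
qed

text \<open>The points to the left of \<open>I\<close> are above it by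
  \<open>interval_left_above\<close>. If none were to the right and above, the points to the right
  would all be below, and the left part \<open>L\<close>, then \<open>I\<close>, then the rest would
  descend: \<open>L\<close>, or \<open>I\<close> if \<open>L\<close> is empty, would be a skew
  cut.\<close>

lemma interval_upper_right:
  assumes gp: "general_position S" and sk: "skew_cuts S = {}" and int: "interval_of S I"
    and m: "m \<in> I" "lr_min S m" and I: "I \<noteq> S"
  shows "\<exists>p \<in> S. \<forall>q \<in> I. fst q < fst p \<and> snd q < snd p"
proof (rule ccontr)
  assume none: "\<not> ?thesis"
  have IS: "I \<subseteq> S" using int unfolding interval_of_def by blast
  define L where "L = {p \<in> S. p \<notin> I \<and> fst p < fst m}"
  have L: "\<forall>r \<in> I. fst p < fst r \<and> snd r < snd p" if "p \<in> L" for p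
    using interval_left_above[OF gp int m _ _ m(1)] that by (auto simp: L_def)
  have R: "\<forall>r \<in> I. fst r < fst p \<and> snd p < snd r" if p: "p \<in> S" "p \<notin> I" "p \<notin> L" for p
  proof -
    have "\<not> fst p < fst m" using p by (simp add: L_def)
    then have "\<forall>r \<in> I. fst r < fst p" using interval_fst[OF gp int p(1,2)] m(1) by blast
    moreover from this have "\<not> (\<forall>r \<in> I. snd r < snd p)" using none p(1) by blast
    ultimately show ?thesis using interval_snd[OF gp int p(1,2)] by blast
  qed
  show False
  proof (cases "L = {}")
    case True
    have "I \<in> skew_cuts S"
      unfolding skew_cuts_def using R True m(1) IS I by blast
    then show False using sk by blast
  next
    case False
    have "fst a < fst b \<and> snd b < snd a" if a: "a \<in> L" and b: "b \<in> S - L" for a b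
    proof (cases "b \<in> I")
      case True
      then show ?thesis using L[OF a] by blast
    next
      case False
      then show ?thesis using L[OF a] R[of b] b m(1) by fastforce
    qed
    moreover have "L \<subset> S" using m(1) IS by (auto simp: L_def)
    ultimately have "L \<in> skew_cuts S" unfolding skew_cuts_def using False by blast
    then show False using sk by blast
  qed
qed

section \<open>One cutting step and its iteration\<close>

context ddagger_pattern
begin

text \<open>The count drops because \<open>J \<mapsto> J - {z}\<close> maps the proper intervals of
  the enlarged set injectively to those of \<open>S\<close> other than \<open>I\<close>.\<close>

lemma destroy_interval:
  assumes gp: "general_position S" and av: "avoids \<pi> S" and sk: "skew_cuts S = {}"
    and cov: "meets_lr_min S" and I: "I \<in> proper_intervals S"
  obtains z where "general_position (insert z S)" "avoids \<pi> (insert z S)"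
    "skew_cuts (insert z S) = {}" "meets_lr_min (insert z S)"
    "card (proper_intervals (insert z S)) < card (proper_intervals S)"
proof -
  have fin: "finite S" using gp unfolding general_position_def by blast
  have int: "interval_of S I" and I2: "2 \<le> card I" and IneqS: "I \<noteq> S"
    using I unfolding proper_intervals_def by auto
  have IS: "I \<subseteq> S" using int unfolding interval_of_def by blast
  have finI: "finite I" using finite_subset[OF IS fin] .
  have "I \<noteq> {}" using I2 by auto
  obtain m where m: "m \<in> I" "lr_min S m" using cov I unfolding meets_lr_min_def by blast
  obtain w where w: "w \<in> I" "\<And>p. p \<in> I \<Longrightarrow> snd w \<le> snd p" using ex_lowest[OF finI \<open>I \<noteq> {}\<close>] by blast
  have wS: "w \<in> S" using w IS by blast
  \<comment> \<open>A second point \<open>y\<close> of \<open>I\<close> lies above \<open>w\<close>,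
    and \<open>z\<close> will be vertically between them; this is how \<open>z\<close> cuts
    \<open>I\<close>.\<close>
  have "I \<noteq> {w}" using I2 by auto
  then obtain y where y: "y \<in> I" "y \<noteq> w" using w(1) by blast
  have wy: "snd w < snd y"
    using w(2)[OF y(1)] general_position_eqI[OF gp, of w y] y IS wS by fastforce
  define R where "R = {p \<in> S. \<forall>q \<in> I. fst q < fst p \<and> snd q < snd p}"
  have "R \<noteq> {}" using interval_upper_right[OF gp sk int m IneqS] unfolding R_def by blast
  moreover have "finite R" using fin by (simp add: R_def)
  ultimately obtain f where f: "f \<in> R" "\<And>p. p \<in> R \<Longrightarrow> snd f \<le> snd p" using ex_lowest by blast
  have fS: "f \<in> S" and fI: "\<And>q. q \<in> I \<Longrightarrow> fst q < fst f \<and> snd q < snd f" using f(1) unfolding R_def by blast+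
  obtain zx where zx: "fst f < zx" "\<And>b. b \<in> fst ` S \<Longrightarrow> fst f < b \<Longrightarrow> zx < b"
    using gap_above[of "fst ` S" "fst f"] fin by blast
  obtain zy where zy: "snd w < zy" "\<And>b. b \<in> snd ` S \<Longrightarrow> snd w < b \<Longrightarrow> zy < b"
    using gap_above[of "snd ` S" "snd w"] fin by blast
  define z where "z = (zx, zy)"
  have z: "fst f < fst z" "\<And>p. p \<in> S \<Longrightarrow> fst f < fst p \<Longrightarrow> fst z < fst p"
    "snd w < snd z" "\<And>p. p \<in> S \<Longrightarrow> snd w < snd p \<Longrightarrow> snd z < snd p"
    using zx zy by (auto simp: z_def)
  have zS: "fst z \<notin> fst ` S" "snd z \<notin> snd ` S"
    using zx(1) zx(2)[of zx] zy(1) zy(2)[of zy] by (auto simp: z_def)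
  then have znS: "z \<notin> S" by blast
  have gp': "general_position (insert z S)" using general_position_insert[OF gp zS] .
  have av': "avoids \<pi> (insert z S)"
  proof (rule avoids_insert_decreasing[OF gp av int w _ fS fI _ z])
    show "snd w < snd p" if "p \<in> S" "p \<notin> I" "fst p < fst w" for p
      using interval_left_above[OF gp int m that(1,2) w(1) that(3)] w(1) by blast
    show "snd f \<le> snd p" if "p \<in> S" "\<forall>q \<in> I. fst q < fst p \<and> snd q < snd p" for p
      using f(2)[of p] that by (simp add: R_def)
  qed
  have wz: "fst w < fst z" using fI[OF w(1)] z(1) by simp
  have sk': "skew_cuts (insert z S) = {}"
    using skew_cuts_insert_empty[OF sk znS wS wS] wz z(3) by blast
  have zy: "snd z < snd y" using z(4)[OF _ wy] y(1) IS by blast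
  have zf: "snd z < snd f" using z(4)[OF fS] fI[OF w(1)] by simp
  have yf: "snd y < snd f" using fI[OF y(1)] by simp
  let ?S = "insert z S"
  have sep: False if "interval_of ?S J" "c \<in> ?S" "c \<notin> J" "a \<in> J" "b \<in> J"
    "(fst a < fst c \<and> fst c < fst b) \<or> (snd a < snd c \<and> snd c < snd b)" for J a b c
    using that unfolding interval_of_def by blast
  \<comment> \<open>Suppose \<open>J\<close> misses \<open>f\<close>. As \<open>z\<close> is to the
    right of \<open>f\<close>, so is all of \<open>J\<close>, and \<open>J\<close> is disjoint from
    \<open>I\<close>. Another point \<open>k\<close> of \<open>J\<close> is then separated from
    \<open>z\<close> vertically: by \<open>w\<close> if \<open>k\<close> is below \<open>w\<close>,
    and otherwise by \<open>y\<close>, because \<open>k\<close> is then above all of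
    \<open>I\<close>. Once \<open>f\<close> is in \<open>J\<close>, so is \<open>y\<close>, which
    lies vertically between \<open>z\<close> and \<open>f\<close>.\<close>
  have fyJ: "f \<in> J \<and> y \<in> J" if J: "interval_of ?S J" "z \<in> J" "J \<noteq> {z}" for J
  proof -
    have yS: "y \<in> ?S" and fS': "f \<in> ?S" using y IS fS by auto
    have "f \<in> J"
    proof (rule ccontr)
      assume fJ: "f \<notin> J"
      obtain k where k: "k \<in> J" "k \<noteq> z" using J by blast
      then have kS: "k \<in> S" using J unfolding interval_of_def by blast
      have "fst k \<noteq> fst f" using general_position_eqI[OF gp kS fS] fJ k(1) by blast
      then have kf: "fst f < fst k" using sep[OF J(1) fS' fJ k(1) J(2)] z(1) by fastforce
      then have kI: "k \<notin> I" using fI by fastforce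
      have right: "\<not> q \<in> J" if "q \<in> I" for q
      proof
        assume "q \<in> J"
        then show False using sep[OF J(1) fS' fJ _ k(1), of q] fI[OF that] kf by blast
      qed
      show False
      proof (cases "snd k < snd w")
        case True
        then show False using sep[OF J(1) _ right[OF w(1)] k(1) J(2)] wS z(3) by blast
      next
        case False
        have "snd w \<noteq> snd k" using general_position_eqI[OF gp wS kS] kI w(1) by blast
        then have "snd w < snd k" using False by simp
        then have "snd y < snd k" using interval_snd[OF gp int kS kI] w(1) y(1) by fastforce
        then show False using sep[OF J(1) yS right[OF y(1)] J(2) k(1)] zy by blast
      qed
    qed
    moreover have "y \<in> J"
    proof (rule ccontr)
      assume "y \<notin> J"
      then show False using sep[OF J(1) yS _ J(2) \<open>f \<in> J\<close>] zy yf by blast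
    qed
    ultimately show ?thesis by blast
  qed
  have fy: "f \<noteq> y" using yf by auto
  have fyz: "f \<noteq> z" "y \<noteq> z" using znS fS y IS by auto
  \<comment> \<open>At least two points remain, namely \<open>f\<close> and \<open>y\<close> if
    \<open>z\<close> was removed. The result is not \<open>S\<close>, as \<open>z\<close> separates
    \<open>w\<close> from \<open>f\<close>. It is not \<open>I\<close>: with \<open>z\<close> in
    \<open>J\<close> it contains \<open>f\<close>, and without \<open>z\<close> the points
    \<open>w\<close> and \<open>y\<close> would be separated by \<open>z\<close>.\<close>
  have image: "J - {z} \<in> proper_intervals S - {I}" if J: "J \<in> proper_intervals ?S" for J
  proof -
    have Jint: "interval_of ?S J" and J2: "2 \<le> card J" and JneqS: "J \<noteq> ?S"
      using J unfolding proper_intervals_def by auto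
    have JS: "J \<subseteq> ?S" using Jint unfolding interval_of_def by blast
    have finJ: "finite J" using finite_subset[OF JS] fin by simp
    have "2 \<le> card (J - {z})"
    proof (cases "z \<in> J")
      case True
      have "J \<noteq> {z}" using J2 by auto
      then have "{f, y} \<subseteq> J - {z}" using fyJ[OF Jint True] fyz by blast
      then have "card {f, y} \<le> card (J - {z})" using finJ by (intro card_mono) auto
      then show ?thesis using fy by simp
    qed (use J2 in simp)
    moreover have "J - {z} \<noteq> S"
    proof
      assume eq: "J - {z} = S"
      then have "z \<notin> J" using JneqS by blast
      then show False using sep[OF Jint, of z w f] eq wS fS z(3) zf by blast
    qed
    moreover have "J - {z} \<noteq> I"
    proof
      assume eq: "J - {z} = I"
      then have wyJ: "w \<in> J" "y \<in> J" using w(1) y(1) by auto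
      show False
      proof (cases "z \<in> J")
        case True
        have "f \<notin> I" using fI by fastforce
        then have "f \<notin> J" using eq fyz by blast
        moreover have "J \<noteq> {z}" using J2 by auto
        ultimately show False using fyJ[OF Jint True] by blast
      next
        case False
        then show False using sep[OF Jint _ False wyJ] z(3) zy by blast
      qed
    qed
    ultimately show ?thesis
      using interval_of_Diff[OF Jint znS] unfolding proper_intervals_def by blast
  qed
  \<comment> \<open>Injectivity could fail only if \<open>J'\<close> and \<open>insert z J'\<close>
    were both proper intervals. Then \<open>J'\<close> contains \<open>f\<close> but not
    \<open>w\<close>, and it contains a left-to-right minimum \<open>n\<close>. If \<open>n\<close>
    is below \<open>w\<close>, then \<open>z\<close> separates \<open>n\<close> from
    \<open>f\<close> vertically; otherwise \<open>n\<close> is to the left of \<open>w\<close>, and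
    \<open>w\<close> separates them horizontally.\<close>
  have inj: "J = J'" if J: "J \<in> proper_intervals ?S" "J' \<in> proper_intervals ?S" "J - {z} = J' - {z}"
    "z \<in> J" for J J'
  proof (rule ccontr)
    assume "J \<noteq> J'"
    then have zJ': "z \<notin> J'" and JJ': "J = insert z J'" using J(3,4) by auto
    have Jint: "interval_of ?S J" and J'int: "interval_of ?S J'" and J2: "2 \<le> card J"
      using J unfolding proper_intervals_def by auto
    have "J \<noteq> {z}" using J2 by auto
    then have fy': "f \<in> J'" "y \<in> J'" using fyJ[OF Jint J(4)] JJ' fyz by auto
    have wJ': "w \<notin> J'" using sep[OF J'int _ zJ' _ fy'(1), of w] z(3) zf by blast
    have "J' \<in> proper_intervals S" using image[OF J(2)] zJ' by simp
    then obtain n where n: "n \<in> J'" "lr_min S n" using cov unfolding meets_lr_min_def by blast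
    then have nS: "n \<in> S" unfolding lr_min_def by blast
    have ne: "fst n \<noteq> fst w" "snd n \<noteq> snd w"
      using general_position_eqI[OF gp nS wS] n(1) wJ' by blast+
    show False
    proof (cases "snd n < snd w")
      case True
      then show False using sep[OF J'int _ zJ' n(1) fy'(1)] z(3) zf by simp
    next
      case False
      then have "snd w < snd n" using ne by simp
      then have "fst n < fst w" using n(2) wS ne unfolding lr_min_def by fastforce
      then show False using sep[OF J'int _ wJ' n(1) fy'(1)] wS fI[OF w(1)] by blast
    qed
  qed
  have "inj_on (\<lambda>J. J - {z}) (proper_intervals ?S)"
  proof (rule inj_onI)
    fix J J' assume J: "J \<in> proper_intervals ?S" "J' \<in> proper_intervals ?S" "J - {z} = J' - {z}"
    show "J = J'"
    proof (cases "z \<in> J \<or> z \<in> J'")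
      case True
      then show ?thesis using inj[OF J] inj[OF J(2,1) J(3)[symmetric]] by blast
    qed (use J(3) in simp)
  qed
  then have "card (proper_intervals ?S) \<le> card (proper_intervals S - {I})"
    using image finite_proper_intervals[OF fin] by (intro card_inj_on_le[of "\<lambda>J. J - {z}"]) auto
  also have "\<dots> < card (proper_intervals S)"
    using I finite_proper_intervals[OF fin] by (intro psubset_card_mono) auto
  finally have card: "card (proper_intervals ?S) < card (proper_intervals S)" .
  have "meets_lr_min ?S"
    unfolding meets_lr_min_def
  proof
    fix J assume "J \<in> proper_intervals ?S"
    then obtain n where n: "n \<in> J - {z}" "lr_min S n" using image cov unfolding meets_lr_min_def by blast
    \<comment> \<open>Since \<open>w\<close> is to the left of and below \<open>z\<close>, it would
      otherwise be to the left of and below \<open>n\<close> as well.\<close>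
    have "\<not> (fst z < fst n \<and> snd z < snd n)"
      using n(2) wS wz z(3) unfolding lr_min_def by fastforce
    then show "\<exists>n \<in> J. lr_min ?S n" using lr_min_insert[OF n(2)] n(1) by blast
  qed
  then show ?thesis using that gp' av' sk' card by blast
qed

lemma extend_to_no_intervals:
  assumes "general_position S" "avoids \<pi> S" "skew_cuts S = {}" "meets_lr_min S"
  shows "\<exists>T. S \<subseteq> T \<and> general_position T \<and> avoids \<pi> T \<and> proper_intervals T = {}"
  using assms
proof (induction "card (proper_intervals S)" arbitrary: S rule: less_induct)
  case less
  show ?case
  proof (cases "proper_intervals S = {}")
    case True
    then show ?thesis using less.prems by blast
  next
    case False
    then obtain I where "I \<in> proper_intervals S" by blast
    then obtain z where "general_position (insert z S)" "avoids \<pi> (insert z S)"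
      "skew_cuts (insert z S) = {}" "meets_lr_min (insert z S)"
      "card (proper_intervals (insert z S)) < card (proper_intervals S)"
      using destroy_interval[OF less.prems] by blast
    then show ?thesis using less.hyps[of "insert z S"] by blast
  qed
qed

end

subsection \<open>Preliminary extensions\<close>

text \<open>Termination measure for the insertion of minima; \<open>meets_lr_minI\<close> shows that
  its emptiness is enough.\<close>

definition unseparated_pairs :: "point set \<Rightarrow> (point \<times> point) set" where
  "unseparated_pairs S = {(u, v). u \<in> S \<and> v \<in> S \<and> \<not> lr_min S u \<and> \<not> lr_min S v \<and> fst u < fst v \<and>
     (\<nexists>m. lr_min S m \<and> fst u < fst m \<and> fst m < fst v)}"

lemma finite_unseparated_pairs: "finite S \<Longrightarrow> finite (unseparated_pairs S)"
  unfolding unseparated_pairs_def by (rule finite_subset[of _ "S \<times> S"]) auto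

text \<open>In a proper interval free of left-to-right minima, any two points form an unseparated
  pair, because a minimum horizontally between them would belong to the interval.\<close>

lemma meets_lr_minI:
  assumes gp: "general_position S" and none: "unseparated_pairs S = {}"
  shows "meets_lr_min S"
  unfolding meets_lr_min_def
proof (rule ballI, rule ccontr)
  fix K assume K: "K \<in> proper_intervals S" and no: "\<not> (\<exists>m \<in> K. lr_min S m)"
  have int: "interval_of S K" and K2: "2 \<le> card K" using K unfolding proper_intervals_def by auto
  have KS: "K \<subseteq> S" using int unfolding interval_of_def by blast
  obtain T where "T \<subseteq> K" "card T = 2" using K2 obtain_subset_with_card_n by blast
  then obtain p q where pq: "p \<in> K" "q \<in> K" "p \<noteq> q" by (auto simp: card_2_iff)
  have "fst p \<noteq> fst q" using general_position_eqI[OF gp, of p q] pq KS by blast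
  then obtain u v where uv: "u \<in> K" "v \<in> K" "fst u < fst v" using pq by (metis linorder_neqE)
  have "\<not> (fst u < fst m \<and> fst m < fst v)" if "lr_min S m" for m
    using int uv no that unfolding interval_of_def lr_min_def by blast
  then have "(u, v) \<in> unseparated_pairs S"
    using uv no KS unfolding unseparated_pairs_def by blast
  then show False using none by blast
qed

section \<open>Inserting left-to-right minima\<close>

context ddagger_pattern
begin

text \<open>A left-to-right minimum can only play 1. The rest of the copy is then to the right of
  and above \<open>z\<close>, hence also of \<open>w\<close>, which is to the left of
  \<open>z\<close> and next above it; so \<open>w\<close> can replace \<open>z\<close>.\<close>

lemma avoids_insert_lr_min:
  assumes gp: "general_position S" and av: "avoids \<pi> S" and w: "w \<in> S" "fst w < fst z" "snd z < snd w"
    and z: "lr_min (insert z S) z" and next_above: "\<And>p. p \<in> S \<Longrightarrow> snd z < snd p \<Longrightarrow> snd w \<le> snd p"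
  shows "avoids \<pi> (insert z S)"
proof (rule avoids_insert[OF av])
  fix g k assume g: "copy_of \<pi> (insert z S) g" and k: "k < length \<pi>" "g k = z"
  have len: "0 < length \<pi>" using k by linarith
  have k0: "k = 0"
  proof (rule ccontr)
    assume "k \<noteq> 0"
    then have "fst (g 0) < fst z" "snd (g 0) < snd z" using copy_first[OF g _ k(1)] k(2) by auto
    moreover have "g 0 \<in> insert z S" using g len unfolding copy_of_def by blast
    ultimately show False using z unfolding lr_min_def by blast
  qed
  have "copy_of \<pi> S (g(k := w))"
  proof (rule copy_replace[OF g k w(1)])
    fix i assume i: "i < length \<pi>"
    have ge: "fst z \<le> fst (g i)" "snd z \<le> snd (g i)"
      using copy_first[OF g, of i] k0 k(2) i by (cases "i = 0"; simp)+
    show "fst (g i) < fst w" if "fst (g i) < fst z" using ge that by simp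
    show "snd (g i) < snd w" if "snd (g i) < snd z" using ge that by simp
    show "fst w < fst (g i)" if "fst z < fst (g i)" using w(2) that by simp
    show "snd w < snd (g i)" if *: "snd z < snd (g i)"
    proof -
      have ik: "i \<noteq> k" using * k(2) by auto
      have S: "g i \<in> S" using copy_other[OF g k i ik] .
      have "g i \<noteq> w" using ge(1) w(2) by auto
      then have "snd (g i) \<noteq> snd w" using general_position_eqI[OF gp S w(1)] by blast
      then show ?thesis using next_above[OF S *] by simp
    qed
  qed
  then show False using av unfolding avoids_def by blast
qed

text \<open>The new minimum \<open>z\<close> goes immediately to the right of \<open>u\<close>,
  hence before \<open>v\<close>, and immediately below the lowest point \<open>w\<close> to the left
  of \<open>u\<close>. Such a \<open>w\<close> exists, and is below \<open>u\<close>, because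
  \<open>u\<close> is not itself a left-to-right minimum.\<close>

lemma separate_pair:
  assumes gp: "general_position S" and av: "avoids \<pi> S" and sk: "skew_cuts S = {}"
    and uv: "(u, v) \<in> unseparated_pairs S"
  obtains z where "general_position (insert z S)" "avoids \<pi> (insert z S)" "skew_cuts (insert z S) = {}"
    "card (unseparated_pairs (insert z S)) < card (unseparated_pairs S)"
proof -
  have fin: "finite S" using gp unfolding general_position_def by blast
  have u: "u \<in> S" "\<not> lr_min S u" and v: "v \<in> S" and ltuv: "fst u < fst v"
    using uv unfolding unseparated_pairs_def by auto
  define L where "L = {p \<in> S. fst p < fst u}"
  have "L \<noteq> {}" using u unfolding lr_min_def L_def by blast
  moreover have "finite L" using fin by (simp add: L_def)
  ultimately obtain w where w: "w \<in> L" "\<And>p. p \<in> L \<Longrightarrow> snd w \<le> snd p" using ex_lowest by blast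
  have wS: "w \<in> S" and wu: "fst w < fst u" using w(1) by (auto simp: L_def)
  obtain n where n: "n \<in> S" "fst n < fst u" "snd n < snd u" using u unfolding lr_min_def by blast
  then have wu': "snd w < snd u" using w(2)[of n] by (simp add: L_def)
  obtain zx where zx: "fst u < zx" "\<And>b. b \<in> fst ` S \<Longrightarrow> fst u < b \<Longrightarrow> zx < b"
    using gap_above[of "fst ` S" "fst u"] fin by blast
  obtain zy where zy: "zy < snd w" "\<And>b. b \<in> snd ` S \<Longrightarrow> b < snd w \<Longrightarrow> b < zy"
    using gap_below[of "snd ` S" "snd w"] fin by blast
  define z where "z = (zx, zy)"
  have z: "fst u < fst z" "\<And>p. p \<in> S \<Longrightarrow> fst u < fst p \<Longrightarrow> fst z < fst p"
    "snd z < snd w" "\<And>p. p \<in> S \<Longrightarrow> snd p < snd w \<Longrightarrow> snd p < snd z"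
    using zx zy by (auto simp: z_def)
  have zS: "fst z \<notin> fst ` S" "snd z \<notin> snd ` S"
    using zx(1) zx(2)[of zx] zy(1) zy(2)[of zy] by (auto simp: z_def)
  then have znS: "z \<notin> S" by blast
  let ?S = "insert z S"
  have gp': "general_position ?S" using general_position_insert[OF gp zS] .
  have zmin: "lr_min ?S z"
    unfolding lr_min_def
  proof (intro conjI ballI notI)
    fix p assume p: "p \<in> ?S" "fst p < fst z \<and> snd p < snd z"
    then have pS: "p \<in> S" by auto
    then have "fst p \<le> fst u" using z(2)[of p] p(2) by fastforce
    moreover have "p \<noteq> u" using p(2) z(3) wu' by auto
    then have "fst p \<noteq> fst u" using general_position_eqI[OF gp pS u(1)] by blast
    ultimately have "p \<in> L" using pS by (simp add: L_def)
    then show False using w(2) p(2) z(3) by fastforce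
  qed simp
  have next_above: "snd w \<le> snd p" if "p \<in> S" "snd z < snd p" for p using z(4)[of p] that by fastforce
  have wz: "fst w < fst z" using wu z(1) by simp
  have av': "avoids \<pi> ?S" using avoids_insert_lr_min[OF gp av wS wz z(3) zmin next_above] .
  have zv: "fst z < fst v" using z(2)[OF v ltuv] .
  have sk': "skew_cuts ?S = {}"
    using skew_cuts_insert_empty[OF sk znS u(1) v] z(1) zv by blast
  \<comment> \<open>If \<open>z\<close> were to the left of and below \<open>m\<close>, then so
    would be \<open>w\<close>, the next point above \<open>z\<close>.\<close>
  have keep: "lr_min ?S m" if m: "lr_min S m" for m
  proof -
    have mS: "m \<in> S" using m unfolding lr_min_def by blast
    have "\<not> (fst z < fst m \<and> snd z < snd m)"
    proof
      assume *: "fst z < fst m \<and> snd z < snd m"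
      then have "snd w \<le> snd m" using next_above[OF mS] by blast
      moreover have "m \<noteq> w" using * wz by auto
      then have "snd m \<noteq> snd w" using general_position_eqI[OF gp mS wS] by blast
      ultimately show False using m wS wz * unfolding lr_min_def by fastforce
    qed
    then show ?thesis using lr_min_insert[OF m] by blast
  qed
  \<comment> \<open>The point \<open>z\<close> is a minimum, so it belongs to no such pair. Old
    minima persist, so no new pair arises, and \<open>z\<close> separates \<open>u\<close> from
    \<open>v\<close>.\<close>
  have "unseparated_pairs ?S \<subseteq> unseparated_pairs S - {(u, v)}"
  proof
    fix c assume "c \<in> unseparated_pairs ?S"
    then obtain p q where c: "c = (p, q)" and pq: "p \<in> ?S" "q \<in> ?S" "\<not> lr_min ?S p" "\<not> lr_min ?S q"
      "fst p < fst q" and none: "\<And>m. lr_min ?S m \<Longrightarrow> \<not> (fst p < fst m \<and> fst m < fst q)"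
      unfolding unseparated_pairs_def by blast
    have "p \<in> S" "q \<in> S" using pq zmin by auto
    then have "(p, q) \<in> unseparated_pairs S"
      using pq none keep unfolding unseparated_pairs_def by blast
    moreover have "(p, q) \<noteq> (u, v)" using none[OF zmin] z(1) zv by auto
    ultimately show "c \<in> unseparated_pairs S - {(u, v)}" using c by blast
  qed
  then have "unseparated_pairs ?S \<subset> unseparated_pairs S" using uv by blast
  then have "card (unseparated_pairs ?S) < card (unseparated_pairs S)"
    by (rule psubset_card_mono[OF finite_unseparated_pairs[OF fin]])
  then show ?thesis using that gp' av' sk' by blast
qed

lemma extend_to_meets_lr_min:
  assumes "general_position S" "avoids \<pi> S" "skew_cuts S = {}"
  shows "\<exists>T. S \<subseteq> T \<and> general_position T \<and> avoids \<pi> T \<and> skew_cuts T = {} \<and> meets_lr_min T"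
  using assms
proof (induction "card (unseparated_pairs S)" arbitrary: S rule: less_induct)
  case less
  show ?case
  proof (cases "unseparated_pairs S = {}")
    case True
    then show ?thesis using less.prems meets_lr_minI by blast
  next
    case False
    then obtain u v where "(u, v) \<in> unseparated_pairs S" by (metis equals0I surj_pair)
    then obtain z where "general_position (insert z S)" "avoids \<pi> (insert z S)"
      "skew_cuts (insert z S) = {}" "card (unseparated_pairs (insert z S)) < card (unseparated_pairs S)"
      using separate_pair[OF less.prems] by blast
    then show ?thesis using less.hyps[of "insert z S"] by blast
  qed
qed

text \<open>If the last entry of \<open>\<pi>\<close> is not its maximum, one point makes the set skew-indecomposable. Otherwise \<open>\<pi> ! 1\<close>
  is below the last entry, and skew cuts are removed one at a time.\<close>

lemma append_top:
  assumes gp: "general_position S" and av: "avoids \<pi> S"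
    and last: "i < length \<pi>" "\<pi> ! (length \<pi> - 1) < \<pi> ! i"
  shows "\<exists>z. general_position (insert z S) \<and> avoids \<pi> (insert z S) \<and> skew_cuts (insert z S) = {}"
proof -
  have fin: "finite S" using gp unfolding general_position_def by blast
  \<comment> \<open>A point to the right of and above all others; the inserted 0 keeps
    \<open>Max\<close> defined when \<open>S\<close> is empty.\<close>
  define z :: point where "z = (Max (insert 0 (fst ` S)) + 1, Max (insert 0 (snd ` S)) + 1)"
  have z: "fst p < fst z" "snd p < snd z" if "p \<in> S" for p
  proof -
    have "fst p \<le> Max (insert 0 (fst ` S))" "snd p \<le> Max (insert 0 (snd ` S))"
      using fin that by (auto intro!: Max_ge)
    then show "fst p < fst z" "snd p < snd z" by (auto simp: z_def)
  qed
  have "fst z \<notin> fst ` S" "snd z \<notin> snd ` S" using z by fastforce+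
  then have gp': "general_position (insert z S)" using general_position_insert[OF gp] by blast
  have av': "avoids \<pi> (insert z S)"
  proof (rule avoids_insert[OF av])
    fix g k assume g: "copy_of \<pi> (insert z S) g" and k: "k < length \<pi>" "g k = z"
    have inS: "g j \<in> S" if "j < length \<pi>" "j \<noteq> k" for j using copy_other[OF g k that] .
    have l: "length \<pi> - 1 < length \<pi>" using k by linarith
    \<comment> \<open>Being rightmost, \<open>z\<close> must play the last entry, but then the
      larger entry \<open>i\<close> would lie above the topmost point.\<close>
    have "\<not> k < length \<pi> - 1"
      using copy_fst_less[OF g k(1) l] z(1)[OF inS[OF l]] k(2) by fastforce
    then have k': "k = length \<pi> - 1" using k by linarith
    then have "i \<noteq> k" using last by auto
    moreover have "snd z < snd (g i)" using copy_snd_less[OF g distinct k(1) last(1)] last(2) k' k(2) by simp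
    ultimately show False using z(2)[OF inS[OF last(1)]] by simp
  qed
  have "A \<notin> skew_cuts (insert z S)" for A
  proof
    assume A: "A \<in> skew_cuts (insert z S)"
    have "p \<in> A \<longleftrightarrow> z \<in> A" if "p \<in> S" for p
      using skew_cut_sameside[OF A, of p z] z that by simp
    then show False using A unfolding skew_cuts_def by blast
  qed
  then show ?thesis using gp' av' by blast
qed

text \<open>With \<open>a\<close> the lowest point of \<open>A\<close> and \<open>b\<close> the
  leftmost point outside, \<open>z\<close> is put immediately above \<open>a\<close> and immediately
  to the right of \<open>b\<close>. It is in increasing position with both, so every remaining cut
  has \<open>a\<close>, \<open>b\<close> and \<open>z\<close> on one side. Thus \<open>A\<close> is
  lost, and deleting \<open>z\<close> is injective on the cuts.\<close>

lemma destroy_skew_cut: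
  assumes gp: "general_position S" and av: "avoids \<pi> S" and A: "A \<in> skew_cuts S"
    and last: "\<And>i. i < length \<pi> \<Longrightarrow> \<pi> ! i \<le> \<pi> ! (length \<pi> - 1)"
  obtains z where "general_position (insert z S)" "avoids \<pi> (insert z S)"
    "card (skew_cuts (insert z S)) < card (skew_cuts S)"
proof -
  have fin: "finite S" using gp unfolding general_position_def by blast
  have AS: "A \<subseteq> S" "A \<noteq> {}" "S - A \<noteq> {}"
    and cut: "\<And>p q. p \<in> A \<Longrightarrow> q \<in> S \<Longrightarrow> q \<notin> A \<Longrightarrow> fst p < fst q \<and> snd q < snd p"
    using A unfolding skew_cuts_def by blast+
  have "finite A" using AS fin finite_subset by blast
  then obtain a where a: "a \<in> A" "\<And>p. p \<in> A \<Longrightarrow> snd a \<le> snd p" using ex_lowest AS(2) by blast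
  have "finite (S - A)" using fin by blast
  then obtain b where b: "b \<in> S - A" "\<And>p. p \<in> S - A \<Longrightarrow> fst b \<le> fst p" using ex_leftmost AS(3) by blast
  have aS: "a \<in> S" and bS: "b \<in> S" and bA: "b \<notin> A" using a b AS by auto
  have ab: "fst a < fst b" "snd b < snd a" using cut[OF a(1) bS bA] by auto
  obtain zx where zx: "fst b < zx" "\<And>c. c \<in> fst ` S \<Longrightarrow> fst b < c \<Longrightarrow> zx < c"
    using gap_above[of "fst ` S" "fst b"] fin by blast
  obtain zy where zy: "snd a < zy" "\<And>c. c \<in> snd ` S \<Longrightarrow> snd a < c \<Longrightarrow> zy < c"
    using gap_above[of "snd ` S" "snd a"] fin by blast
  define z where "z = (zx, zy)"
  have z: "fst b < fst z" "\<And>p. p \<in> S \<Longrightarrow> fst b < fst p \<Longrightarrow> fst z < fst p"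
    "snd a < snd z" "\<And>p. p \<in> S \<Longrightarrow> snd a < snd p \<Longrightarrow> snd z < snd p"
    using zx zy by (auto simp: z_def)
  have zS: "fst z \<notin> fst ` S" "snd z \<notin> snd ` S"
    using zx(1) zx(2)[of zx] zy(1) zy(2)[of zy] by (auto simp: z_def)
  then have znS: "z \<notin> S" by blast
  let ?S = "insert z S"
  have gp': "general_position ?S" using general_position_insert[OF gp zS] .
  have right: "snd p < snd a" if p: "p \<in> S" "fst z < fst p" for p
  proof -
    have "p \<notin> A" using cut[of p b] p bS bA z(1) by fastforce
    then show ?thesis using cut[OF a(1) p(1)] by blast
  qed
  have av': "avoids \<pi> ?S"
  proof (rule avoids_insert[OF av])
    fix g k assume g: "copy_of \<pi> ?S g" and k: "k < length \<pi>" "g k = z"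
    have inS: "g i \<in> S" if "i < length \<pi>" "i \<noteq> k" for i using copy_other[OF g k that] .
    have l0: "0 < length \<pi>" and l1: "1 < length \<pi>" using length_gt_2 by linarith+
    define n where "n = length \<pi> - 1"
    have n: "n < length \<pi>" "1 < n" using length_gt_2 by (auto simp: n_def)
    have above_first: "\<pi> ! 1 < \<pi> ! n"
    proof -
      have "\<pi> ! 1 \<noteq> \<pi> ! n" using n l1 distinct by (simp add: nth_eq_iff_index_eq)
      then show ?thesis using last[OF l1] by (simp add: n_def)
    qed
    have after: "snd (g i) < snd a" if i: "i < length \<pi>" "k < i" for i
      using right[OF inS[OF i(1)]] copy_fst_less[OF g k(1) i(1)] i k(2) by simp
    have k0: "k \<noteq> 0"
    proof
      assume "k = 0"
      then have "snd z < snd (g 1)" "snd (g 1) < snd a"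
        using copy_first(2)[OF g _ l1] after[OF l1] k(2) by auto
      then show False using z(3) by simp
    qed
    define x where "x = g 0"
    have x: "x \<in> S" "fst x < fst z" "snd x < snd z"
      using inS[OF l0] k0 copy_first[OF g _ k(1)] k(2) by (auto simp: x_def)
    \<comment> \<open>The first entry \<open>x\<close> of the copy is \<open>a\<close> or
      \<open>b\<close>. If it is \<open>a\<close>, then \<open>z\<close> plays the last entry, since
      later points are below \<open>a\<close>, and \<open>g 1\<close> falls into the gap between
      \<open>a\<close> and \<open>z\<close>. If it is \<open>b\<close>, then \<open>z\<close> plays
      the second entry, and the larger last entry would have to be below \<open>a\<close>.\<close>
    show False
    proof (cases "x \<in> A")
      case True
      have "snd x \<le> snd a" using z(4)[OF x(1)] x(3) by fastforce
      then have "snd x = snd a" using a(2)[OF True] by simp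
      then have xa: "x = a" using general_position_eqI[OF gp x(1) aS] by blast
      have kn: "k = n"
      proof (rule ccontr)
        assume "k \<noteq> n"
        then have "k < n" using k(1) by (simp add: n_def)
        then have "snd (g n) < snd a" using after[OF n(1)] by blast
        moreover have "snd a < snd (g n)"
          using copy_first(2)[OF g _ n(1)] n(2) xa by (simp add: x_def)
        ultimately show False by simp
      qed
      then have "1 \<noteq> k" using n by simp
      moreover have "snd a < snd (g 1)" using copy_first(2)[OF g _ l1] xa by (simp add: x_def)
      moreover have "snd (g 1) < snd z"
        using copy_snd_less[OF g distinct l1 k(1)] above_first kn k(2) by simp
      ultimately show False using z(4)[OF inS[OF l1]] by fastforce
    next
      case False
      have "fst x \<le> fst b" using z(2)[OF x(1)] x(2) by fastforce
      then have "fst x = fst b" using b(2)[of x] x(1) False by simp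
      then have xb: "x = b" using general_position_eqI[OF gp x(1) bS] by blast
      have k1: "k = 1"
      proof (rule ccontr)
        assume "k \<noteq> 1"
        then have "1 < k" using k0 by simp
        then have "fst (g 1) < fst z" using copy_fst_less[OF g l1 k(1)] k(2) by simp
        moreover have "fst b < fst (g 1)" using copy_first(1)[OF g _ l1] xb by (simp add: x_def)
        ultimately show False using z(2)[OF inS[OF l1]] \<open>k \<noteq> 1\<close> by fastforce
      qed
      have "snd z < snd (g n)" using copy_snd_less[OF g distinct l1 n(1)] above_first k1 k(2) by simp
      moreover have "snd (g n) < snd a" using after[OF n(1)] n(2) k1 by simp
      ultimately show False using z(3) by simp
    qed
  qed
  have same: "a \<in> A' \<longleftrightarrow> z \<in> A'" "b \<in> A' \<longleftrightarrow> z \<in> A'" if A': "A' \<in> skew_cuts ?S" for A'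
    using skew_cut_sameside[OF A', of a z] skew_cut_sameside[OF A', of b z] aS bS ab z(1,3) by auto
  have image: "A' - {z} \<in> skew_cuts S - {A}" if A': "A' \<in> skew_cuts ?S" for A'
  proof -
    have sub: "A' \<noteq> {}" "A' \<subset> ?S"
      and cut': "\<And>p q. p \<in> A' \<Longrightarrow> q \<in> ?S - A' \<Longrightarrow> fst p < fst q \<and> snd q < snd p"
      using A' unfolding skew_cuts_def by blast+
    have "A' - {z} \<noteq> {}" using sub(1) same(1)[OF A'] aS znS by blast
    moreover have "A' - {z} \<subset> S" using sub(2) same(1)[OF A'] aS znS by blast
    moreover have "fst p < fst q \<and> snd q < snd p" if "p \<in> A' - {z}" "q \<in> S - (A' - {z})" for p q
      using cut'[of p q] that znS by auto
    ultimately have "A' - {z} \<in> skew_cuts S" unfolding skew_cuts_def by blast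
    moreover have "A' - {z} \<noteq> A" using same[OF A'] a(1) bA bS aS znS by blast
    ultimately show ?thesis by blast
  qed
  have "inj_on (\<lambda>A'. A' - {z}) (skew_cuts ?S)"
  proof (rule inj_onI)
    fix A' B' assume AB: "A' \<in> skew_cuts ?S" "B' \<in> skew_cuts ?S" "A' - {z} = B' - {z}"
    then have "z \<in> A' \<longleftrightarrow> z \<in> B'" using same(1)[OF AB(1)] same(1)[OF AB(2)] aS znS by blast
    then show "A' = B'" using AB(3) by blast
  qed
  then have "card (skew_cuts ?S) \<le> card (skew_cuts S - {A})"
    using image finite_skew_cuts[OF fin] by (intro card_inj_on_le[of "\<lambda>A'. A' - {z}"]) auto
  also have "\<dots> < card (skew_cuts S)"
    using A finite_skew_cuts[OF fin] by (intro psubset_card_mono) auto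
  finally show ?thesis using that gp' av' by blast
qed

lemma extend_to_skew_indecomposable:
  assumes "general_position S" "avoids \<pi> S"
  shows "\<exists>T. S \<subseteq> T \<and> general_position T \<and> avoids \<pi> T \<and> skew_cuts T = {}"
proof (cases "\<exists>i < length \<pi>. \<pi> ! (length \<pi> - 1) < \<pi> ! i")
  case True
  then obtain z where "general_position (insert z S)" "avoids \<pi> (insert z S)" "skew_cuts (insert z S) = {}"
    using append_top[OF assms] by blast
  then show ?thesis by (intro exI[of _ "insert z S"]) auto
next
  case False
  then have last: "\<pi> ! i \<le> \<pi> ! (length \<pi> - 1)" if "i < length \<pi>" for i using that not_le by blast
  show ?thesis
    using assms
  proof (induction "card (skew_cuts S)" arbitrary: S rule: less_induct)
    case less
    show ?case
    proof (cases "skew_cuts S = {}")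
      case True
      then show ?thesis using less.prems by blast
    next
      case False
      then obtain A where "A \<in> skew_cuts S" by blast
      then obtain z where "general_position (insert z S)" "avoids \<pi> (insert z S)"
        "card (skew_cuts (insert z S)) < card (skew_cuts S)"
        by (rule destroy_skew_cut[OF less.prems _ last])
      then show ?thesis using less.hyps[of "insert z S"] by blast
    qed
  qed
qed

lemma extend_to_simple:
  assumes "general_position S" "avoids \<pi> S"
  obtains T where "S \<subseteq> T" "general_position T" "avoids \<pi> T" "proper_intervals T = {}"
proof -
  obtain S1 where "S \<subseteq> S1" and S1: "general_position S1" "avoids \<pi> S1" "skew_cuts S1 = {}"
    using extend_to_skew_indecomposable[OF assms] by blast
  moreover obtain S2 where "S1 \<subseteq> S2" and S2: "general_position S2" "avoids \<pi> S2" "skew_cuts S2 = {}" "meets_lr_min S2"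
    using extend_to_meets_lr_min[OF S1] by blast
  moreover obtain T where "S2 \<subseteq> T" "general_position T" "avoids \<pi> T" "proper_intervals T = {}"
    using extend_to_no_intervals[OF S2] by blast
  ultimately show ?thesis using that[of T] by blast
qed

end

subsection \<open>Permutations as point sets\<close>

definition represents :: "nat list \<Rightarrow> point set \<Rightarrow> (nat \<Rightarrow> point) \<Rightarrow> bool" where
  "represents \<sigma> S g \<longleftrightarrow> bij_betw g {..<length \<sigma>} S \<and>
     (\<forall>i < length \<sigma>. \<forall>j < length \<sigma>. fst (g i) < fst (g j) \<longleftrightarrow> i < j) \<and>
     (\<forall>i < length \<sigma>. \<forall>j < length \<sigma>. snd (g i) < snd (g j) \<longleftrightarrow> \<sigma> ! i < \<sigma> ! j)"

lemma is_perm_iff: "is_perm p \<longleftrightarrow> distinct p \<and> set p = {1..length p}"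
  unfolding is_perm_def permutations_of_set_def by auto

text \<open>Increasing index maps are the form in which subsequences can be compared with copies in
  point sets.\<close>

lemma subseq_iff_index_map:
  "subseq xs ys \<longleftrightarrow> (\<exists>h. (\<forall>i j. i < j \<and> j < length xs \<longrightarrow> h i < h j) \<and>
     (\<forall>i < length xs. h i < length ys \<and> xs ! i = ys ! h i))" (is "_ \<longleftrightarrow> ?R xs ys")
proof
  show "subseq xs ys \<Longrightarrow> ?R xs ys"
  proof (induction rule: list_emb.induct)
    case (list_emb_Nil ys)
    show ?case by simp
  next
    case (list_emb_Cons xs ys y)
    then obtain h where "\<forall>i j. i < j \<and> j < length xs \<longrightarrow> h i < h j"
      "\<forall>i < length xs. h i < length ys \<and> xs ! i = ys ! h i" by blast
    then show ?case by (intro exI[of _ "\<lambda>i. Suc (h i)"]) auto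
  next
    case (list_emb_Cons2 x y xs ys)
    then obtain h where h: "\<forall>i j. i < j \<and> j < length xs \<longrightarrow> h i < h j"
      "\<forall>i < length xs. h i < length ys \<and> xs ! i = ys ! h i" by blast
    show ?case
    proof (intro exI[of _ "\<lambda>i. case i of 0 \<Rightarrow> 0 | Suc i \<Rightarrow> Suc (h i)"] conjI allI impI)
      fix i j assume "i < j \<and> j < length (x # xs)"
      then show "(case i of 0 \<Rightarrow> 0 | Suc i \<Rightarrow> Suc (h i)) < (case j of 0 \<Rightarrow> 0 | Suc i \<Rightarrow> Suc (h i))"
        using h(1) by (auto split: nat.split)
    next
      fix i assume "i < length (x # xs)"
      then show "(case i of 0 \<Rightarrow> 0 | Suc i \<Rightarrow> Suc (h i)) < length (y # ys)"
        "(x # xs) ! i = (y # ys) ! (case i of 0 \<Rightarrow> 0 | Suc i \<Rightarrow> Suc (h i))"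
        using h(2) list_emb_Cons2(1) by (auto split: nat.split)
    qed
  qed
next
  assume "?R xs ys"
  then obtain h where h: "\<And>i j. i < j \<Longrightarrow> j < length xs \<Longrightarrow> h i < h j"
    "\<And>i. i < length xs \<Longrightarrow> h i < length ys \<and> xs ! i = ys ! h i" by blast
  \<comment> \<open>The chosen indices form a subsequence of \<open>[0..<length ys]\<close>; looking
    up the entries of \<open>ys\<close> then carries this over to \<open>xs\<close> and
    \<open>ys\<close>.\<close>
  have "sorted_wrt (<) (map h [0..<length xs])" using h(1) by (simp add: sorted_wrt_iff_nth_less)
  then have "subseq (map h [0..<length xs]) [0..<length ys]"
    using h(2) by (intro sorted_subset_imp_subseq) (auto simp: sorted_wrt_iff_nth_less)
  then have "subseq (map ((!) ys) (map h [0..<length xs])) (map ((!) ys) [0..<length ys])"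
    by (rule subseq_map)
  moreover have "map ((!) ys) (map h [0..<length xs]) = xs"
    using h(2) by (intro nth_equalityI) auto
  ultimately show "subseq xs ys" by (simp add: map_nth)
qed

lemma contained_in_iff_copy:
  assumes rep: "represents \<sigma> S g" and dist: "distinct \<alpha>"
  shows "contained_in \<alpha> \<sigma> \<longleftrightarrow> (\<exists>f. copy_of \<alpha> S f)"
proof
  assume "contained_in \<alpha> \<sigma>"
  then obtain s where s: "subseq s \<sigma>" "length \<alpha> = length s"
    "\<And>i j. i < length \<alpha> \<Longrightarrow> j < length \<alpha> \<Longrightarrow> \<alpha> ! i < \<alpha> ! j \<longleftrightarrow> s ! i < s ! j"
    unfolding contained_in_def order_isomorphic_def by blast
  obtain h where h: "\<And>i j. i < j \<Longrightarrow> j < length s \<Longrightarrow> h i < h j"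
    "\<And>i. i < length s \<Longrightarrow> h i < length \<sigma>" "\<And>i. i < length s \<Longrightarrow> s ! i = \<sigma> ! h i"
    using s(1) unfolding subseq_iff_index_map by blast
  have "copy_of \<alpha> S (\<lambda>i. g (h i))"
    unfolding copy_of_def
  proof (intro conjI allI impI)
    fix i assume "i < length \<alpha>"
    then show "g (h i) \<in> S" using rep h(2) s(2) unfolding represents_def bij_betw_def by auto
  next
    fix i j assume "i < j \<and> j < length \<alpha>"
    then show "fst (g (h i)) < fst (g (h j))"
      using rep h(1)[of i j] h(2)[of i] h(2)[of j] s(2) unfolding represents_def by auto
  next
    fix i j assume "i < length \<alpha>" "j < length \<alpha>" "\<alpha> ! i < \<alpha> ! j"
    then show "snd (g (h i)) < snd (g (h j))"
      using rep h(2)[of i] h(2)[of j] h(3)[of i] h(3)[of j] s(2,3) unfolding represents_def by auto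
  qed
  then show "\<exists>f. copy_of \<alpha> S f" by blast
next
  assume "\<exists>f. copy_of \<alpha> S f"
  then obtain f where f: "copy_of \<alpha> S f" by blast
  have "\<exists>m < length \<sigma>. g m = f i" if "i < length \<alpha>" for i
  proof -
    have "f i \<in> g ` {..<length \<sigma>}"
      using f rep that unfolding copy_of_def represents_def bij_betw_def by blast
    then show ?thesis by force
  qed
  then obtain h where h: "\<And>i. i < length \<alpha> \<Longrightarrow> h i < length \<sigma> \<and> g (h i) = f i" by metis
  define s where "s = map (\<lambda>i. \<sigma> ! h i) [0..<length \<alpha>]"
  have "subseq s \<sigma>"
    unfolding subseq_iff_index_map
  proof (intro exI[of _ h] conjI allI impI)
    fix i j assume "i < j \<and> j < length s"
    then have ij: "i < j" "i < length \<alpha>" "j < length \<alpha>" by (auto simp: s_def)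
    then have "fst (g (h i)) < fst (g (h j))" using h copy_fst_less[OF f, of i j] by simp
    then show "h i < h j" using rep h ij unfolding represents_def by blast
  qed (use h in \<open>auto simp: s_def\<close>)
  moreover have "order_isomorphic \<alpha> s"
    unfolding order_isomorphic_def
  proof (intro conjI allI impI)
    fix i j assume ij: "i < length \<alpha>" "j < length \<alpha>"
    have "snd (g (h i)) < snd (g (h j)) \<longleftrightarrow> \<sigma> ! h i < \<sigma> ! h j"
      using rep h[OF ij(1)] h[OF ij(2)] unfolding represents_def by blast
    moreover have "s ! i = \<sigma> ! h i" "s ! j = \<sigma> ! h j" using ij by (auto simp: s_def)
    ultimately have "s ! i < s ! j \<longleftrightarrow> snd (g (h i)) < snd (g (h j))" by simp
    then show "\<alpha> ! i < \<alpha> ! j \<longleftrightarrow> s ! i < s ! j"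
      using copy_snd_less[OF f dist ij] h ij by simp
  qed (simp add: s_def)
  ultimately show "contained_in \<alpha> \<sigma>" unfolding contained_in_def by blast
qed

lemma represents_is_copy:
  assumes "represents \<sigma> S g"
  shows "copy_of \<sigma> S g"
  using assms unfolding represents_def copy_of_def bij_betw_def by auto

lemma copy_mono: "copy_of \<alpha> S f \<Longrightarrow> S \<subseteq> T \<Longrightarrow> copy_of \<alpha> T f"
  unfolding copy_of_def by blast

lemma ex_represented_set:
  assumes "is_perm \<sigma>"
  obtains S g where "general_position S" "represents \<sigma> S g"
proof -
  define g where "g i = (real i, real (\<sigma> ! i))" for i
  have dist: "distinct \<sigma>" using assms by (simp add: is_perm_iff)
  have "general_position (g ` {..<length \<sigma>})"
    using dist unfolding general_position_def inj_on_def by (auto simp: g_def nth_eq_iff_index_eq)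
  moreover have "represents \<sigma> (g ` {..<length \<sigma>}) g"
    unfolding represents_def bij_betw_def inj_on_def by (auto simp: g_def)
  ultimately show ?thesis using that by blast
qed

text \<open>The points are listed from left to right, and each is given its vertical rank as
  value.\<close>

lemma ex_representing_perm:
  assumes gp: "general_position S"
  obtains \<sigma> g where "is_perm \<sigma>" "represents \<sigma> S g"
proof -
  have fin: "finite S" and injf: "inj_on fst S" and injs: "inj_on snd S"
    using gp unfolding general_position_def by auto
  define xs where "xs = sorted_list_of_set (fst ` S)"
  define g where "g i = the_inv_into S fst (xs ! i)" for i
  \<comment> \<open>The point itself is counted, so the ranks run from 1 to
    \<open>card S\<close>.\<close>
  define rank :: "point \<Rightarrow> nat" where "rank p = card {q \<in> S. snd q \<le> snd p}" for p
  define \<sigma> where "\<sigma> = map (\<lambda>i. rank (g i)) [0..<card S]"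
  have xs: "set xs = fst ` S" "length xs = card S" "sorted_wrt (<) xs"
    using fin injf by (auto simp: xs_def card_image)
  have len: "length \<sigma> = card S" by (simp add: \<sigma>_def)
  have g: "g i \<in> S" "fst (g i) = xs ! i" if "i < card S" for i
  proof -
    have "xs ! i \<in> fst ` S" using xs that by (metis nth_mem)
    then show "g i \<in> S" "fst (g i) = xs ! i"
      using injf by (auto simp: g_def the_inv_into_into f_the_inv_into_f)
  qed
  have fst_less: "fst (g i) < fst (g j) \<longleftrightarrow> i < j" if "i < card S" "j < card S" for i j
    using xs(2,3) that g(2) by (metis less_asym linorder_neqE_nat less_irrefl sorted_wrt_iff_nth_less)
  have inj: "inj_on g {..<card S}"
    using fst_less by (intro inj_onI) (metis lessThan_iff less_irrefl linorder_neqE_nat)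
  have "g ` {..<card S} \<subseteq> S" using g(1) by auto
  then have bij: "bij_betw g {..<card S} S"
    using inj fin unfolding bij_betw_def by (simp add: card_image card_subset_eq)
  have rank_less: "rank p < rank q" if "p \<in> S" "q \<in> S" "snd p < snd q" for p q
  proof -
    have "q \<in> {r \<in> S. snd r \<le> snd q}" "q \<notin> {r \<in> S. snd r \<le> snd p}" using that by auto
    moreover have "{r \<in> S. snd r \<le> snd p} \<subseteq> {r \<in> S. snd r \<le> snd q}" using that(3) by fastforce
    ultimately have "{r \<in> S. snd r \<le> snd p} \<subset> {r \<in> S. snd r \<le> snd q}" by blast
    then show ?thesis unfolding rank_def using fin by (intro psubset_card_mono) auto
  qed
  have rank_iff: "snd p < snd q \<longleftrightarrow> rank p < rank q" if pq: "p \<in> S" "q \<in> S" for p q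
  proof (cases "snd p = snd q")
    case True
    then show ?thesis by (simp add: rank_def)
  next
    case False
    then show ?thesis using rank_less[OF pq] rank_less[OF pq(2,1)] by fastforce
  qed
  have rank_inj: "inj_on rank S"
    using rank_less injs unfolding inj_on_def by (metis less_irrefl linorder_neqE)
  have rank_range: "rank p \<in> {1..card S}" if "p \<in> S" for p
  proof -
    have "{q \<in> S. snd q \<le> snd p} \<noteq> {}" using that by blast
    then have "0 < rank p" using fin by (simp add: rank_def card_gt_0_iff)
    moreover have "rank p \<le> card S" unfolding rank_def using fin by (intro card_mono) auto
    ultimately show ?thesis by simp
  qed
  have "rank ` S = {1..card S}"
    using rank_range rank_inj by (intro card_subset_eq) (auto simp: card_image)
  moreover have "set \<sigma> = rank ` g ` {..<card S}"
    by (simp add: \<sigma>_def image_image atLeast0LessThan)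
  then have "set \<sigma> = rank ` S"
    using bij by (simp add: bij_betw_def)
  moreover have "distinct \<sigma>"
    using comp_inj_on[OF inj, of rank] rank_inj bij
    by (simp add: \<sigma>_def distinct_map bij_betw_def comp_def atLeast0LessThan)
  ultimately have "is_perm \<sigma>" by (simp add: is_perm_iff len)
  moreover have "represents \<sigma> S g"
    unfolding represents_def len
  proof (intro conjI allI impI)
    fix i j assume ij: "i < card S" "j < card S"
    show "fst (g i) < fst (g j) \<longleftrightarrow> i < j" using fst_less[OF ij] .
    show "snd (g i) < snd (g j) \<longleftrightarrow> \<sigma> ! i < \<sigma> ! j"
      using rank_iff[OF g(1)[OF ij(1)] g(1)[OF ij(2)]] ij by (simp add: \<sigma>_def)
  qed (fact bij)
  ultimately show ?thesis using that by blast
qed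

text \<open>Along \<open>g\<close>, an interval of \<open>\<sigma>\<close> becomes an interval of
  \<open>S\<close> of the same size that is not all of \<open>S\<close>; it is nonempty, so only
  size 1 is left.\<close>

lemma simple_permI:
  assumes perm: "is_perm \<sigma>" and rep: "represents \<sigma> S g" and none: "proper_intervals S = {}"
  shows "simple_perm \<sigma>"
  unfolding simple_perm_def
proof (intro conjI allI impI)
  fix I assume "is_interval \<sigma> I"
  then obtain a b c d where I: "I \<noteq> {}" "I \<subset> {..<length \<sigma>}" "I = {a..b}" "(\<lambda>i. \<sigma> ! i) ` I = {c..d}"
    unfolding is_interval_def by blast
  have dist: "distinct \<sigma>" using perm by (simp add: is_perm_iff)
  have g: "inj_on g {..<length \<sigma>}" "g ` {..<length \<sigma>} = S"
    using rep unfolding represents_def bij_betw_def by auto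
  have gf: "fst (g i) < fst (g j) \<longleftrightarrow> i < j" and gs: "snd (g i) < snd (g j) \<longleftrightarrow> \<sigma> ! i < \<sigma> ! j"
    if "i < length \<sigma>" "j < length \<sigma>" for i j
    using rep that unfolding represents_def by auto
  have "interval_of S (g ` I)"
    unfolding interval_of_def
  proof (intro conjI ballI)
    show "g ` I \<subseteq> S" using I(2) g(2) by blast
    fix p q r assume "p \<in> S - g ` I" "q \<in> g ` I" "r \<in> g ` I"
    then obtain k i j where k: "p = g k" "k < length \<sigma>" "k \<notin> I" and i: "q = g i" "i \<in> I" and j: "r = g j" "j \<in> I"
      using g(2) by auto
    have ij: "i < length \<sigma>" "j < length \<sigma>" using i j I(2) by auto
    show "\<not> (fst q < fst p \<and> fst p < fst r)"
      using gf ij k i j I(3) by auto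
    show "\<not> (snd q < snd p \<and> snd p < snd r)"
    proof
      assume "snd q < snd p \<and> snd p < snd r"
      then have "\<sigma> ! i < \<sigma> ! k" "\<sigma> ! k < \<sigma> ! j" using gs ij k i j by auto
      moreover have "\<sigma> ! i \<in> {c..d}" "\<sigma> ! j \<in> {c..d}" using I(4) i j by blast+
      \<comment> \<open>The values on \<open>I\<close> fill the whole range from \<open>c\<close> to
        \<open>d\<close>, so a value between two of them is already taken inside
        \<open>I\<close>.\<close>
      ultimately have "\<sigma> ! k \<in> (\<lambda>i. \<sigma> ! i) ` I" unfolding I(4) by simp
      then obtain l where "l \<in> I" "\<sigma> ! k = \<sigma> ! l" by blast
      then show False using dist k I(2) by (auto simp: nth_eq_iff_index_eq)
    qed
  qed
  moreover have "g ` I \<noteq> S"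
    using I(2) g inj_on_image_eq_iff[OF g(1), of I "{..<length \<sigma>}"] by blast
  ultimately have "\<not> 2 \<le> card (g ` I)" using none unfolding proper_intervals_def by blast
  moreover have "card (g ` I) = card I" using inj_on_subset[OF g(1)] I(2) by (intro card_image) blast
  moreover have "card I \<noteq> 0" using I(1,3) by simp
  ultimately show "card I = 1" by linarith
qed (fact perm)

section \<open>From simple extensions to non-deflatability\<close>

lemma not_deflatableI:
  assumes "\<And>p. p \<in> C \<Longrightarrow> is_perm p \<and> (\<exists>q \<in> C. simple_perm q \<and> contained_in p q)"
  shows "\<not> deflatable C"
proof
  assume "deflatable C"
  then obtain D where D: "perm_class D" "D \<subset> C" "C \<subseteq> substitution_closure D"
    unfolding deflatable_def by blast
  then obtain p where p: "p \<in> C" "p \<notin> D" by blast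
  then obtain q where q: "q \<in> C" "simple_perm q" "contained_in p q" using assms by blast
  \<comment> \<open>The closure adds no simple permutations, so \<open>q\<close> belongs to
    \<open>D\<close>; since \<open>D\<close> is closed under containment, so does \<open>p\<close>,
    against its choice.\<close>
  then have "q \<in> simples (substitution_closure D)" using D(3) unfolding simples_def by blast
  then have "q \<in> D" using substitution_closure_greatest(2)[OF D(1)] unfolding simples_def by blast
  then show False using D(1) p q(3) assms unfolding perm_class_def by blast
qed

lemma ddagger_pattern_one_oplus:
  assumes perm: "is_perm \<rho>" and bonds: "\<not> (\<exists>i. decreasing_bond \<rho> i)" and dd: "ddagger (one_oplus \<rho>)"
  shows "ddagger_pattern (one_oplus \<rho>)"
proof -
  let ?p = "one_oplus \<rho>"
  have \<rho>: "distinct \<rho>" "set \<rho> = {1..length \<rho>}" using perm by (auto simp: is_perm_iff)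
  have nth: "?p ! Suc i = Suc (\<rho> ! i)" if "i < length \<rho>" for i using that by (simp add: one_oplus_def)
  have nth0: "?p ! 0 = 1" by (simp add: one_oplus_def)
  have len: "length ?p = Suc (length \<rho>)" by (simp add: one_oplus_def)
  have pos: "1 \<le> \<rho> ! i" "\<rho> ! i \<le> length \<rho>" if "i < length \<rho>" for i
    using \<rho>(2) nth_mem[OF that] by auto
  have ge2: "2 \<le> ?p ! i" if i: "0 < i" "i < length ?p" for i
    using i len nth[of "i - 1"] pos(1)[of "i - 1"] by (cases i) auto
  show ?thesis
  proof
    show "distinct ?p" using \<rho> by (auto simp: one_oplus_def distinct_map)
    show "?p ! 0 < ?p ! i" if "0 < i" "i < length ?p" for i using ge2[OF that] nth0 by simp
    obtain t j where tj: "t < j" "j < length ?p" "?p ! t = 2" "?p ! j < ?p ! 1"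
      using dd unfolding ddagger_def by blast
    have "0 < t" using tj(3) nth0 by (cases t) auto
    then show "\<exists>t j. 0 < t \<and> t < j \<and> j < length ?p \<and> ?p ! j < ?p ! 1 \<and>
        (\<forall>i. 0 < i \<and> i < length ?p \<longrightarrow> ?p ! t \<le> ?p ! i)"
      by (intro exI[of _ t] exI[of _ j]) (use tj ge2 in auto)
    fix i assume i: "0 < i" "Suc i < length ?p" "?p ! Suc i < ?p ! i"
    then obtain m where m: "i = Suc m" "Suc m < length \<rho>" using len by (cases i) auto
    then have less: "\<rho> ! Suc m < \<rho> ! m" using i(3) nth by simp
    then have "\<rho> ! m \<noteq> Suc (\<rho> ! Suc m)"
      using bonds m(2) unfolding decreasing_bond_def bond_def by blast
    then have "Suc (\<rho> ! Suc m) < \<rho> ! m" using less by simp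
    \<comment> \<open>A descent of \<open>\<rho>\<close> that is not a bond drops by at least 2, so
      the value just above its lower end occurs in \<open>\<rho>\<close> and lies strictly between
      its two entries.\<close>
    moreover from this have "Suc (\<rho> ! Suc m) \<in> set \<rho>" using \<rho>(2) pos(2)[of m] m(2) by simp
    then obtain l where "l < length \<rho>" "\<rho> ! l = Suc (\<rho> ! Suc m)" by (auto simp: in_set_conv_nth)
    ultimately show "\<exists>l < length ?p. ?p ! Suc i < ?p ! l \<and> ?p ! l < ?p ! i"
      using m nth len by (intro exI[of _ "Suc l"]) simp
  qed
qed

theorem theorem3p6:
  fixes \<pi> \<rho> :: "nat list"
  assumes "is_perm \<rho>"
    and "\<pi> = one_oplus \<rho>"
    and "starts_with_descent \<rho>"
    and "\<not> (\<exists>i. decreasing_bond \<rho> i)"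
    and "ddagger \<pi>"
  shows "\<not> deflatable (Av \<pi>)"
proof (rule not_deflatableI)
  interpret ddagger_pattern \<pi> using ddagger_pattern_one_oplus assms by blast
  fix p assume p: "p \<in> Av \<pi>"
  then have perm: "is_perm p" unfolding Av_def by blast
  then have dist: "distinct p" by (simp add: is_perm_iff)
  obtain S g where S: "general_position S" "represents p S g" using ex_represented_set[OF perm] .
  have "avoids \<pi> S"
    using p contained_in_iff_copy[OF S(2) distinct] unfolding Av_def avoids_def by blast
  then obtain T where T: "S \<subseteq> T" "general_position T" "avoids \<pi> T" "proper_intervals T = {}"
    using extend_to_simple[OF S(1)] by blast
  obtain q h where q: "is_perm q" "represents q T h" using ex_representing_perm[OF T(2)] .
  have "q \<in> Av \<pi>"
    using q(1) T(3) contained_in_iff_copy[OF q(2) distinct] unfolding Av_def avoids_def by blast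
  moreover have "simple_perm q" using simple_permI[OF q T(4)] .
  moreover have "contained_in p q"
    using contained_in_iff_copy[OF q(2) dist] copy_mono[OF represents_is_copy[OF S(2)] T(1)] by blast
  ultimately show "is_perm p \<and> (\<exists>q \<in> Av \<pi>. simple_perm q \<and> contained_in p q)" using perm by blast
qed

end
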